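(* Suppose LTE uses listen-before-talk with random back-off with $(a,b)=(1,2)$, i.e. AP timers $t_i^W$ are uniform on $[0,1]$ and eNB timers $t_k^L$ are uniform on $[1,2]$, so that the medium access indicators of AP $x_i$ and eNB $y_k$ are $$e_i^W=\prod_{x_j\in\Phi_W\setminus\{x_i\}}\Bigl(\mathbf 1_{\{t_j^W\ge t_i^W\}}+\mathbf 1_{\{t_j^W<t_i^W\}}\mathbf 1_{\{G^W_{j,i}/l(\|x_j-x_i\|)\le\Gamma_{cs}/P_W\}}\Bigr),$$ $$e_k^L=\prod_{x_j\in\Phi_W}\mathbf 1_{\{G^{WL}_{j,k}/l(\|x_j-y_k\|)\le\Gamma^L/P_W\}}\prod_{y_m\in\Phi_L\setminus\{y_k\}}\Bigl(\mathbf 1_{\{t_m^L\ge t_k^L\}}+\mathbf 1_{\{t_m^L<t_k^L\}}\mathbf 1_{\{G^{L}_{m,k}/l(\|y_m-y_k\|)\le\Gamma^L/P_L\}}\Bigr).$$ Then the medium access probabilities of a typical AP and a typical eNB (the Palm probabilities, with respect to $\Phi_W$ and $\Phi_L$ respectively, that the indicator of the typical point equals $1$) are $$p^W_{4,\mathrm{MAP}}(\lambda_W,\lambda_L)=\frac{1-\exp(-N^W)}{N^W},\qquad p^L_{4,\mathrm{MAP}}(\lambda_W,\lambda_L)=\exp(-N_3^W(\Gamma^L))\,\frac{1-\exp(-N_3^L(\Gamma^L))}{N_3^L(\Gamma^L)}.$$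
   Context: Wi-Fi access points (APs) form a homogeneous Poisson point process $\Phi_W=\{x_i\}$ on $\mathbb R^2$ with intensity $\lambda_W>0$; LTE base stations (eNBs) form an independent homogeneous Poisson point process $\Phi_L=\{y_k\}$ on $\mathbb R^2$ with intensity $\lambda_L>0$. Transmit powers are $P_W,P_L>0$. The path loss is $l(d)=(4\pi/\lambda_c)^2 d^{\alpha}$ with wavelength $\lambda_c>0$ and path loss exponent $\alpha>0$. $\Gamma_{cs}>0$ is Wi-Fi's carrier sensing threshold and $\Gamma^L>0$ is the LTE sensing threshold. $G^W_{j,i},G^{WL}_{j,k},G^L_{m,k}$ are the fadings from AP $x_j$ to AP $x_i$, AP $x_j$ to eNB $y_k$, eNB $y_m$ to eNB $y_k$; all fading variables are i.i.d. exponential with $\mathbb P(G>s)=e^{-\mu s}$, $\mu>0$. The point processes, the timers and the fading variables are all mutually independent. Define, for $\Gamma>0$, $$N_3^L(\Gamma)=\lambda_L\int_{\mathbb R^2}\exp\Bigl(-\mu\tfrac{\Gamma}{P_L}l(\|x\|)\Bigr)dx,\quad N_3^W(\Gamma)=\lambda_W\int_{\mathbb R^2}\exp\Bigl(-\mu\tfrac{\Gamma}{P_W}l(\|x\|)\Bigr)dx,$$ and $N^W=N_3^W(\Gamma_{cs})$. *)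

theory Defs
  imports "HOL-Probability.Probability"
begin

section \<open>Point processes in the plane\<close>

text \<open>A point process is given by a measurable enumeration of its points
  (\<^term>\<open>X i \<omega>\<close> is the \<^term>\<open>i\<close>-th point), almost surely without repetitions and locally
  finite; the number of points in \<^term>\<open>B\<close> is then the number of indices \<^term>\<open>i\<close> with
  \<^term>\<open>X i \<omega> \<in> B\<close>. A homogeneous Poisson process of positive intensity on the plane has
  almost surely infinitely many points, so \<^typ>\<open>nat\<close> is the right index type.
  The Poisson weights are written out because the library's Poisson distribution excludes
  rate 0, which occurs for null sets.\<close>

definition point_count :: "(nat \<Rightarrow> 'a \<Rightarrow> real^2) \<Rightarrow> (real^2) set \<Rightarrow> 'a \<Rightarrow> nat" where
  "point_count X B \<omega> = card {i. X i \<omega> \<in> B}"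

definition homogeneous_poisson_process ::
    "'a measure \<Rightarrow> real \<Rightarrow> (nat \<Rightarrow> 'a \<Rightarrow> real^2) \<Rightarrow> bool" where
  "homogeneous_poisson_process M lam X \<longleftrightarrow>
     (\<forall>i. X i \<in> borel_measurable M) \<and>
     (AE \<omega> in M. inj (\<lambda>i. X i \<omega>)) \<and>
     (AE \<omega> in M. \<forall>r. finite {i. norm (X i \<omega>) \<le> r}) \<and>
     (\<forall>B\<in>sets borel. bounded B \<longrightarrow>
        (\<forall>n. measure M {\<omega> \<in> space M. point_count X B \<omega> = n} =
             (lam * measure lborel B) ^ n / fact n * exp (- (lam * measure lborel B)))) \<and>
     (\<forall>B :: nat \<Rightarrow> (real^2) set.
        (\<forall>k. B k \<in> sets borel \<and> bounded (B k)) \<and> disjoint_family B \<longrightarrow>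
        prob_space.indep_vars M (\<lambda>_. count_space UNIV) (\<lambda>k. point_count X (B k)) UNIV)"

text \<open>Palm probability, with respect to the stationary point process \<^term>\<open>X\<close> of intensity
  \<^term>\<open>lam\<close>, that the typical point has the property \<^term>\<open>E\<close>, where \<^term>\<open>E i \<omega>\<close> says that
  the \<^term>\<open>i\<close>-th point has it: the normalised Campbell measure
  \<open>\<bbbE>[#{i. X i \<in> B, E i}] / (lam * |B|)\<close>, for an observation window \<^term>\<open>B\<close> of positive
  finite area. By stationarity it does not depend on the window.\<close>

definition palm_prob ::
    "'a measure \<Rightarrow> real \<Rightarrow> (nat \<Rightarrow> 'a \<Rightarrow> real^2) \<Rightarrow> (real^2) set \<Rightarrow> (nat \<Rightarrow> 'a \<Rightarrow> bool) \<Rightarrow> ennreal" where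
  "palm_prob M lam X B E =
     (\<integral>\<^sup>+\<omega>. (\<Sum>i. indicator {i. X i \<omega> \<in> B \<and> E i \<omega>} i) \<partial>M) / (ennreal lam * emeasure lborel B)"


section \<open>Medium access\<close>

definition path_loss :: "real \<Rightarrow> real \<Rightarrow> real \<Rightarrow> real" where
  "path_loss lamc \<alpha> d = (4 * pi / lamc)^2 * d powr \<alpha>"

text \<open>Infinite product over the indices in \<^term>\<open>J\<close>. It is only used for factors in
  \<open>{0, 1}\<close>, where the partial products are decreasing and always converge; the library's
  \<^const>\<open>prodinf\<close> would be unspecified if infinitely many factors were 0.\<close>

definition index_prod :: "nat set \<Rightarrow> (nat \<Rightarrow> real) \<Rightarrow> real" where
  "index_prod J f = lim (\<lambda>n. \<Prod>j\<in>J \<inter> {..<n}. f j)"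

text \<open>In the fading families the first index is the transmitter and the second the receiver.\<close>

definition wifi_access ::
    "real \<Rightarrow> real \<Rightarrow> real \<Rightarrow> real \<Rightarrow> (nat \<Rightarrow> 'a \<Rightarrow> real^2) \<Rightarrow> (nat \<Rightarrow> 'a \<Rightarrow> real) \<Rightarrow>
     (nat \<Rightarrow> nat \<Rightarrow> 'a \<Rightarrow> real) \<Rightarrow> nat \<Rightarrow> 'a \<Rightarrow> real" where
  "wifi_access lamc \<alpha> PW \<Gamma>cs X tW GW i \<omega> =
     index_prod (- {i}) (\<lambda>j.
       of_bool (tW j \<omega> \<ge> tW i \<omega>) +
       of_bool (tW j \<omega> < tW i \<omega>) *
       of_bool (GW j i \<omega> / path_loss lamc \<alpha> (norm (X j \<omega> - X i \<omega>)) \<le> \<Gamma>cs / PW))"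

definition lte_access ::
    "real \<Rightarrow> real \<Rightarrow> real \<Rightarrow> real \<Rightarrow> real \<Rightarrow> (nat \<Rightarrow> 'a \<Rightarrow> real^2) \<Rightarrow> (nat \<Rightarrow> 'a \<Rightarrow> real^2) \<Rightarrow>
     (nat \<Rightarrow> 'a \<Rightarrow> real) \<Rightarrow> (nat \<Rightarrow> nat \<Rightarrow> 'a \<Rightarrow> real) \<Rightarrow> (nat \<Rightarrow> nat \<Rightarrow> 'a \<Rightarrow> real) \<Rightarrow>
     nat \<Rightarrow> 'a \<Rightarrow> real" where
  "lte_access lamc \<alpha> PW PL \<Gamma>L X Y tL GWL GL k \<omega> =
     index_prod UNIV (\<lambda>j.
       of_bool (GWL j k \<omega> / path_loss lamc \<alpha> (norm (X j \<omega> - Y k \<omega>)) \<le> \<Gamma>L / PW)) *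
     index_prod (- {k}) (\<lambda>m.
       of_bool (tL m \<omega> \<ge> tL k \<omega>) +
       of_bool (tL m \<omega> < tL k \<omega>) *
       of_bool (GL m k \<omega> / path_loss lamc \<alpha> (norm (Y m \<omega> - Y k \<omega>)) \<le> \<Gamma>L / PL))"

definition N3 :: "real \<Rightarrow> real \<Rightarrow> real \<Rightarrow> real \<Rightarrow> real \<Rightarrow> real \<Rightarrow> real" where
  "N3 lamc \<alpha> \<mu> lam P \<Gamma> =
     lam * (LINT x|lborel. exp (- \<mu> * (\<Gamma> / P) * path_loss lamc \<alpha> (norm (x :: real^2))))"


section \<open>Joint independence\<close>

text \<open>One \<open>\<sigma>\<close>-algebra for each source of randomness. Each point process enters as a single
  source, through its whole enumeration, since its points are not independent of each other;
  every timer and every fading variable is a source of its own.\<close>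

datatype source =
    APs | ENBs | Timer_W nat | Timer_L nat
  | Fading_W nat nat | Fading_WL nat nat | Fading_L nat nat

definition source_events ::
    "'a measure \<Rightarrow> (nat \<Rightarrow> 'a \<Rightarrow> real^2) \<Rightarrow> (nat \<Rightarrow> 'a \<Rightarrow> real^2) \<Rightarrow>
     (nat \<Rightarrow> 'a \<Rightarrow> real) \<Rightarrow> (nat \<Rightarrow> 'a \<Rightarrow> real) \<Rightarrow>
     (nat \<Rightarrow> nat \<Rightarrow> 'a \<Rightarrow> real) \<Rightarrow> (nat \<Rightarrow> nat \<Rightarrow> 'a \<Rightarrow> real) \<Rightarrow> (nat \<Rightarrow> nat \<Rightarrow> 'a \<Rightarrow> real) \<Rightarrow>
     source \<Rightarrow> 'a set set" where
  "source_events M X Y tW tL GW GWL GL s = sets (case s of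
       APs \<Rightarrow> vimage_algebra (space M) (\<lambda>\<omega> i. X i \<omega>) (\<Pi>\<^sub>M i\<in>UNIV. borel)
     | ENBs \<Rightarrow> vimage_algebra (space M) (\<lambda>\<omega> k. Y k \<omega>) (\<Pi>\<^sub>M k\<in>UNIV. borel)
     | Timer_W i \<Rightarrow> vimage_algebra (space M) (tW i) borel
     | Timer_L k \<Rightarrow> vimage_algebra (space M) (tL k) borel
     | Fading_W j i \<Rightarrow> vimage_algebra (space M) (GW j i) borel
     | Fading_WL j k \<Rightarrow> vimage_algebra (space M) (GWL j k) borel
     | Fading_L m k \<Rightarrow> vimage_algebra (space M) (GL m k) borel)"

definition sources_independent ::
    "'a measure \<Rightarrow> (nat \<Rightarrow> 'a \<Rightarrow> real^2) \<Rightarrow> (nat \<Rightarrow> 'a \<Rightarrow> real^2) \<Rightarrow>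
     (nat \<Rightarrow> 'a \<Rightarrow> real) \<Rightarrow> (nat \<Rightarrow> 'a \<Rightarrow> real) \<Rightarrow>
     (nat \<Rightarrow> nat \<Rightarrow> 'a \<Rightarrow> real) \<Rightarrow> (nat \<Rightarrow> nat \<Rightarrow> 'a \<Rightarrow> real) \<Rightarrow> (nat \<Rightarrow> nat \<Rightarrow> 'a \<Rightarrow> real) \<Rightarrow>
     bool" where
  "sources_independent M X Y tW tL GW GWL GL \<longleftrightarrow>
     prob_space.indep_sets M (source_events M X Y tW tL GW GWL GL) UNIV"

end

theory Submission
  imports Defs
begin

text \<open>Given the point processes, the fadings and the timers of the other nodes are independent, so they
  can be integrated out one at a time. A contender at distance \<open>d\<close> starts before a typical node with
  normalised timer \<open>s \<in> [0, 1]\<close> with probability \<open>s\<close>, and then blocks it with probability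
  \<open>h d = exp (- \<mu> (\<Gamma> / P) l d)\<close>. Hence the access probability of the \<open>i\<close>-th node is
  \<open>\<integral> \<Prod>j\<noteq>i. (1 - s h (\<bar>X j - X i\<bar>)) ds\<close>. Mecke's formula for this product functional turns the Palm
  probability into \<open>\<integral> exp (- s N) ds = (1 - exp (- N)) / N\<close>. For an eNB all APs start earlier, so they
  contribute the additional factor \<open>\<Prod>j. (1 - h (\<bar>X j - Y k\<bar>))\<close>, whose mean is the same
  constant \<open>exp (- N)\<close> for every position of the eNB by the Laplace functional of the APs.\<close>

section \<open>Infinite products over index sets\<close>

text \<open>The Poisson process is known only through the joint law of its counts on bounded
  disjoint sets; nothing is given about the law of the \<open>i\<close>-th point of the enumeration.
  Fadings and timers can still be averaged for each fixed index, because they are independent of the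
  enumerations; the points are averaged only after summation over \<open>i\<close>, when the labels
  no longer matter. Mecke's formula is therefore derived from the counts, for products of a kernel
  over the other points. On a finite partition both sides are explicit, through the mean and the
  generating function of the Poisson law, and continuity of the kernel carries the identity to the
  limit. This is why the blocking probability is replaced by a function that is continuous at
  distance 0; the two differ only at coinciding points, which almost surely do not occur. For an
  eNB, the back-off average depends on the eNB positions alone, and the sensing average is taken
  over the APs with the eNB positions frozen, so the two processes are treated one after the
  other.\<close>

lemma prod_anti_mono:
  fixes f :: "'i \<Rightarrow> real"
  assumes "finite B" "A \<subseteq> B" "\<And>j. j \<in> B \<Longrightarrow> 0 \<le> f j" "\<And>j. j \<in> B \<Longrightarrow> f j \<le> 1"
  shows "prod f B \<le> prod f A"
proof -
  have "prod f B = prod f (B - A) * prod f A"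
    by (rule prod.subset_diff[OF assms(2,1)])
  also have "\<dots> \<le> 1 * prod f A"
    using assms by (intro mult_right_mono prod_le_1 prod_nonneg) auto
  finally show ?thesis by simp
qed

lemma index_prod_LIMSEQ:
  assumes "\<And>j. j \<in> J \<Longrightarrow> 0 \<le> f j" "\<And>j. j \<in> J \<Longrightarrow> f j \<le> 1"
  shows "(\<lambda>n. \<Prod>j\<in>J \<inter> {..<n}. f j) \<longlonglongrightarrow> index_prod J f"
proof -
  have "decseq (\<lambda>n. \<Prod>j\<in>J \<inter> {..<n}. f j)"
  proof (rule decseq_SucI)
    fix n
    show "(\<Prod>j\<in>J \<inter> {..<Suc n}. f j) \<le> (\<Prod>j\<in>J \<inter> {..<n}. f j)"
      by (rule prod_anti_mono) (use assms in auto)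
  qed
  moreover have "0 \<le> (\<Prod>j\<in>J \<inter> {..<n}. f j)" for n
    by (rule prod_nonneg) (use assms in auto)
  ultimately have "convergent (\<lambda>n. \<Prod>j\<in>J \<inter> {..<n}. f j)"
    using decseq_convergent[of "\<lambda>n. \<Prod>j\<in>J \<inter> {..<n}. f j" 0] by (metis convergentI)
  then show ?thesis
    unfolding index_prod_def by (simp add: convergent_LIMSEQ_iff)
qed

lemma index_prod_nonneg:
  assumes "\<And>j. j \<in> J \<Longrightarrow> 0 \<le> f j" "\<And>j. j \<in> J \<Longrightarrow> f j \<le> 1"
  shows "0 \<le> index_prod J f"
  by (rule LIMSEQ_le_const[OF index_prod_LIMSEQ[OF assms]]) (use assms in \<open>auto intro!: prod_nonneg\<close>)

lemma index_prod_le_prod: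
  assumes "\<And>j. j \<in> J \<Longrightarrow> 0 \<le> f j" "\<And>j. j \<in> J \<Longrightarrow> f j \<le> 1" and "finite F" "F \<subseteq> J"
  shows "index_prod J f \<le> (\<Prod>j\<in>F. f j)"
proof (rule LIMSEQ_le_const2[OF index_prod_LIMSEQ[OF assms(1,2)]])
  obtain N where N: "F \<subseteq> {..<N}"
    using \<open>finite F\<close> finite_nat_bounded by blast
  have "(\<Prod>j\<in>J \<inter> {..<n}. f j) \<le> (\<Prod>j\<in>F. f j)" if "n \<ge> N" for n
    by (rule prod_anti_mono) (use assms N that in auto)
  then show "\<exists>N. \<forall>n\<ge>N. (\<Prod>j\<in>J \<inter> {..<n}. f j) \<le> (\<Prod>j\<in>F. f j)" by blast
qed auto

lemma index_prod_le_1: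
  assumes "\<And>j. j \<in> J \<Longrightarrow> 0 \<le> f j" "\<And>j. j \<in> J \<Longrightarrow> f j \<le> 1"
  shows "index_prod J f \<le> 1"
  using index_prod_le_prod[of J f "{}"] assms by auto

lemma index_prod_cong:
  assumes "\<And>j. j \<in> J \<Longrightarrow> f j = g j"
  shows "index_prod J f = index_prod J g"
  unfolding index_prod_def using assms by (intro arg_cong[where f=lim] ext prod.cong) auto

lemma index_prod_mono:
  assumes "\<And>j. j \<in> J \<Longrightarrow> 0 \<le> f j" "\<And>j. j \<in> J \<Longrightarrow> f j \<le> g j" "\<And>j. j \<in> J \<Longrightarrow> g j \<le> 1"
  shows "index_prod J f \<le> index_prod J g"
proof (rule LIMSEQ_le)
  show "(\<lambda>n. \<Prod>j\<in>J \<inter> {..<n}. f j) \<longlonglongrightarrow> index_prod J f"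
    by (rule index_prod_LIMSEQ) (use assms order_trans in blast)+
  show "(\<lambda>n. \<Prod>j\<in>J \<inter> {..<n}. g j) \<longlonglongrightarrow> index_prod J g"
    by (rule index_prod_LIMSEQ) (use assms order_trans in blast)+
qed (use assms in \<open>auto intro!: prod_mono exI[of _ 0]\<close>)

lemma index_prod_eq_prod:
  assumes "finite F" "F \<subseteq> J" "\<And>j. j \<in> J - F \<Longrightarrow> f j = 1"
  shows "index_prod J f = (\<Prod>j\<in>F. f j)"
proof -
  obtain N where N: "F \<subseteq> {..<N}"
    using \<open>finite F\<close> finite_nat_bounded by blast
  have "(\<Prod>j\<in>J \<inter> {..<n}. f j) = (\<Prod>j\<in>F. f j)" if "n \<ge> N" for n
    by (rule prod.mono_neutral_right) (use assms N that in auto)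
  then have "(\<lambda>n. \<Prod>j\<in>J \<inter> {..<n}. f j) \<longlonglongrightarrow> (\<Prod>j\<in>F. f j)"
    by (intro tendsto_eventually) (auto simp: eventually_sequentially)
  then show ?thesis unfolding index_prod_def by (rule limI)
qed

text \<open>\<open>{0, 1}\<close> is closed, so the value survives the limit. For an access
  indicator this allows the event "equals 1" to be replaced by the indicator itself under the
  integral.\<close>

lemma index_prod_zero_one:
  assumes "\<And>j. j \<in> J \<Longrightarrow> f j \<in> {0, 1}"
  shows "index_prod J f \<in> {0, 1}"
proof -
  have "(\<Prod>j\<in>J \<inter> {..<n}. f j) \<in> {0, 1}" for n
    using assms by (cases "\<exists>j\<in>J \<inter> {..<n}. f j = 0") (auto intro!: prod.neutral)
  moreover have "(\<lambda>n. \<Prod>j\<in>J \<inter> {..<n}. f j) \<longlonglongrightarrow> index_prod J f"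
    by (rule index_prod_LIMSEQ) (use assms in force)+
  moreover have "closed {0, 1 :: real}" by (simp add: finite_imp_closed)
  ultimately show ?thesis by (rule closed_sequentially[rotated 1])
qed

text \<open>Monotonicity bounds \<open>index_prod J (g m)\<close> from below by
  \<open>index_prod J f\<close>. From above, some finite partial product of \<open>f\<close> is
  already close to the infinite one, and on its finitely many indices \<open>g m\<close> eventually
  agrees with \<open>f\<close>. The application is a growing window: \<open>g m\<close> is 1 at
  points outside it.\<close>

lemma index_prod_tendsto:
  assumes "\<And>j. 0 \<le> f j" "\<And>m j. f j \<le> g m j" "\<And>m j. g m j \<le> 1"
    and "\<And>j. eventually (\<lambda>m. g m j = f j) sequentially"
  shows "(\<lambda>m. index_prod J (g m)) \<longlonglongrightarrow> index_prod J f"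
proof (rule order_tendstoI)
  have f1: "f j \<le> 1" for j using assms(2,3) order_trans by blast
  have g0: "0 \<le> g m j" for m j using assms(1,2) order_trans by blast
  fix a
  {
    assume "a < index_prod J f"
    moreover have "index_prod J f \<le> index_prod J (g m)" for m
      by (rule index_prod_mono) (use assms in auto)
    ultimately show "eventually (\<lambda>m. a < index_prod J (g m)) sequentially"
      by (metis (no_types, lifting) eventually_sequentiallyI less_le_trans)
  next
    assume "index_prod J f < a"
    with index_prod_LIMSEQ[of J f] assms(1) f1
    have "eventually (\<lambda>n. (\<Prod>j\<in>J \<inter> {..<n}. f j) < a) sequentially"
      by (auto dest!: order_tendstoD(2))
    then obtain n where n: "(\<Prod>j\<in>J \<inter> {..<n}. f j) < a"
      by (auto simp: eventually_sequentially)
    have "eventually (\<lambda>m. \<forall>j\<in>J \<inter> {..<n}. g m j = f j) sequentially"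
      using assms(4) by (simp add: eventually_ball_finite)
    then show "eventually (\<lambda>m. index_prod J (g m) < a) sequentially"
    proof eventually_elim
      case (elim m)
      have "index_prod J (g m) \<le> (\<Prod>j\<in>J \<inter> {..<n}. g m j)"
        by (rule index_prod_le_prod) (use assms g0 in auto)
      also have "\<dots> = (\<Prod>j\<in>J \<inter> {..<n}. f j)" using elim by (intro prod.cong) auto
      finally show ?case using n by simp
    qed
  }
qed

lemma borel_measurable_index_prod [measurable]:
  assumes [measurable]: "\<And>j. f j \<in> borel_measurable M"
  shows "(\<lambda>\<omega>. index_prod J (\<lambda>j. f j \<omega>)) \<in> borel_measurable M"
  unfolding index_prod_def by measurable

section \<open>Mean and generating function of a Poisson variable\<close>

context prob_space
begin

lemma nn_integral_nat_valued:
  fixes N :: "'a \<Rightarrow> nat" and f :: "nat \<Rightarrow> ennreal"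
  assumes [measurable]: "N \<in> measurable M (count_space UNIV)"
  shows "(\<integral>\<^sup>+\<omega>. f (N \<omega>) \<partial>M) = (\<Sum>n. f n * ennreal (prob {\<omega>\<in>space M. N \<omega> = n}))"
proof -
  have "f (N \<omega>) = (\<Sum>n. f n * indicator {\<omega>\<in>space M. N \<omega> = n} \<omega>)" if "\<omega> \<in> space M" for \<omega>
  proof -
    have "(\<Sum>n. f n * indicator {\<omega>\<in>space M. N \<omega> = n} \<omega>) =
        (\<Sum>n\<in>{N \<omega>}. f n * indicator {\<omega>\<in>space M. N \<omega> = n} \<omega>)"
      by (rule suminf_finite) auto
    then show ?thesis using that by simp
  qed
  then have "(\<integral>\<^sup>+\<omega>. f (N \<omega>) \<partial>M) = (\<integral>\<^sup>+\<omega>. (\<Sum>n. f n * indicator {\<omega>\<in>space M. N \<omega> = n} \<omega>) \<partial>M)"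
    by (intro nn_integral_cong) auto
  also have "\<dots> = (\<Sum>n. \<integral>\<^sup>+\<omega>. f n * indicator {\<omega>\<in>space M. N \<omega> = n} \<omega> \<partial>M)"
    by (rule nn_integral_suminf) auto
  also have "\<dots> = (\<Sum>n. f n * emeasure M {\<omega>\<in>space M. N \<omega> = n})"
    by (intro arg_cong[where f=suminf] ext nn_integral_cmult_indicator) auto
  finally show ?thesis by (simp add: emeasure_eq_measure)
qed

context
  fixes N :: "'a \<Rightarrow> nat" and a :: real
  assumes meas: "N \<in> measurable M (count_space UNIV)" and a: "0 \<le> a"
    and law: "\<And>n. prob {\<omega>\<in>space M. N \<omega> = n} = a ^ n / fact n * exp (- a)"
begin

lemma poisson_mean: "(\<integral>\<^sup>+\<omega>. of_nat (N \<omega>) \<partial>M) = ennreal a"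
proof -
  have "(\<lambda>n. a ^ n / fact n) sums exp a"
    using exp_converges[of a] by (simp add: field_simps)
  then have "(\<lambda>n. a * exp (- a) * (a ^ n / fact n)) sums (a * exp (- a) * exp a)"
    by (rule sums_mult)
  moreover have "a * exp (- a) * (a ^ n / fact n) = real (Suc n) * (a ^ Suc n / fact (Suc n) * exp (- a))" for n
  proof -
    have "real (Suc n) * (a ^ Suc n / fact (Suc n)) = a * (a ^ n / fact n)"
      by (simp del: of_nat_Suc)
    then show ?thesis by (metis (no_types, lifting) mult.assoc mult.commute)
  qed
  moreover have "a * exp (- a) * exp a = a"
    by (simp add: mult.assoc flip: exp_add)
  ultimately have "(\<lambda>n. real (Suc n) * (a ^ Suc n / fact (Suc n) * exp (- a))) sums a"
    by (simp only:)
  \<comment> \<open>The term for \<open>n = 0\<close> vanishes, so shifting the index changes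
    nothing.\<close>
  then have "(\<lambda>n. real n * (a ^ n / fact n * exp (- a))) sums a"
    using sums_Suc_iff[of "\<lambda>n. real n * (a ^ n / fact n * exp (- a))" a] by simp
  then have "(\<Sum>n. ennreal (real n * (a ^ n / fact n * exp (- a)))) = ennreal a"
    using a by (intro suminf_ennreal_eq) auto
  then show ?thesis
    using a by (subst nn_integral_nat_valued[OF meas, of of_nat])
      (simp add: law ennreal_of_nat_eq_real_of_nat flip: ennreal_mult)
qed

text \<open>The value \<open>z = 0\<close> is included, with \<open>0 ^ 0 = 1\<close>: a kernel that
  vanishes on a cell has no effect when the cell is empty. The kernels used later do vanish at
  distance 0 when the timer is 1.\<close>

lemma poisson_pgf:
  assumes "0 \<le> z"
  shows "(\<integral>\<^sup>+\<omega>. ennreal (z ^ N \<omega>) \<partial>M) = ennreal (exp (- (a * (1 - z))))"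
proof -
  have "(\<lambda>n. (a * z) ^ n / fact n) sums exp (a * z)"
    using exp_converges[of "a * z"] by (simp add: field_simps)
  then have "(\<lambda>n. exp (- a) * ((a * z) ^ n / fact n)) sums (exp (- a) * exp (a * z))"
    by (rule sums_mult)
  then have "(\<lambda>n. z ^ n * (a ^ n / fact n * exp (- a))) sums exp (- (a * (1 - z)))"
    by (simp add: power_mult_distrib field_simps flip: exp_add)
  then have "(\<Sum>n. ennreal (z ^ n * (a ^ n / fact n * exp (- a)))) = ennreal (exp (- (a * (1 - z))))"
    using a assms by (intro suminf_ennreal_eq) auto
  then show ?thesis
    using a assms by (subst nn_integral_nat_valued[OF meas]) (simp add: law flip: ennreal_mult)
qed

end
end

section \<open>Counts of a planar Poisson process\<close>

text \<open>This lemma and the next connect two descriptions of a discretised functional: by cell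
  counts, whose law is known, and by individual points, along which the limit is taken.\<close>

lemma sum_fibres:
  fixes f :: "'c \<Rightarrow> real"
  assumes "finite I" "finite C" "g ` I \<subseteq> C"
  shows "(\<Sum>c\<in>C. real (card {i\<in>I. g i = c}) * f c) = (\<Sum>i\<in>I. f (g i))"
proof -
  have "(\<Sum>i\<in>I. f (g i)) = (\<Sum>c\<in>C. \<Sum>i\<in>{i\<in>I. g i = c}. f (g i))"
    by (rule sum.group[symmetric]) (use assms in auto)
  also have "\<dots> = (\<Sum>c\<in>C. \<Sum>i\<in>{i\<in>I. g i = c}. f c)"
    by (intro sum.cong) auto
  finally show ?thesis by simp
qed

lemma prod_fibres:
  fixes f :: "'c \<Rightarrow> real"
  assumes "finite I" "finite C" "g ` I \<subseteq> C"
  shows "(\<Prod>c\<in>C. f c ^ card {i\<in>I. g i = c}) = (\<Prod>i\<in>I. f (g i))"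
proof -
  have "(\<Prod>i\<in>I. f (g i)) = (\<Prod>c\<in>C. \<Prod>i\<in>{i\<in>I. g i = c}. f (g i))"
    by (rule prod.group[symmetric]) (use assms in auto)
  also have "\<dots> = (\<Prod>c\<in>C. \<Prod>i\<in>{i\<in>I. g i = c}. f c)"
    by (intro prod.cong) auto
  finally show ?thesis by simp
qed

locale planar_poisson = prob_space +
  fixes lam :: real and X :: "nat \<Rightarrow> 'a \<Rightarrow> real^2"
  assumes poisson: "homogeneous_poisson_process M lam X" and intensity_pos: "0 < lam"
begin

lemma measurable_point [measurable]: "X i \<in> borel_measurable M"
  using poisson by (auto simp: homogeneous_poisson_process_def)

lemma AE_inj: "AE \<omega> in M. inj (\<lambda>i. X i \<omega>)"
  using poisson by (auto simp: homogeneous_poisson_process_def)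

lemma AE_finite:
  assumes "bounded W"
  shows "AE \<omega> in M. finite {i. X i \<omega> \<in> W}"
proof -
  obtain r where r: "\<And>x. x \<in> W \<Longrightarrow> norm x \<le> r" using assms by (auto simp: bounded_iff)
  have "AE \<omega> in M. \<forall>r. finite {i. norm (X i \<omega>) \<le> r}"
    using poisson by (auto simp: homogeneous_poisson_process_def)
  then show ?thesis
  proof eventually_elim
    case (elim \<omega>)
    show ?case by (rule finite_subset[OF _ elim[rule_format, of r]]) (auto dest: r)
  qed
qed

lemma indep_counts:
  fixes A :: "nat \<Rightarrow> (real^2) set"
  assumes "\<And>k. A k \<in> sets borel" "\<And>k. bounded (A k)" "disjoint_family A"
  shows "indep_vars (\<lambda>_. count_space UNIV) (\<lambda>k. point_count X (A k)) UNIV"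
  using poisson assms by (auto simp: homogeneous_poisson_process_def)

text \<open>Measurability of a count is part of the independence condition; the set
  \<open>B\<close>, followed by empty sets, is a disjoint family to which that condition
  applies.\<close>

lemma measurable_point_count:
  assumes "B \<in> sets borel" "bounded B"
  shows "point_count X B \<in> measurable M (count_space UNIV)"
proof -
  have "indep_vars (\<lambda>_. count_space UNIV) (\<lambda>k. point_count X (if k = 0 then B else {})) (UNIV :: nat set)"
    by (rule indep_counts) (use assms in \<open>auto simp: disjoint_family_on_def\<close>)
  then have "point_count X (if 0 = (0::nat) then B else {}) \<in> measurable M (count_space UNIV)"
    unfolding indep_vars_def by blast
  then show ?thesis by simp
qed

lemma prob_point_count:
  assumes "B \<in> sets borel" "bounded B"
  shows "prob {\<omega>\<in>space M. point_count X B \<omega> = n} =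
    (lam * measure lborel B) ^ n / fact n * exp (- (lam * measure lborel B))"
  using poisson assms by (auto simp: homogeneous_poisson_process_def)

lemma nn_integral_point_count:
  assumes "B \<in> sets borel" "bounded B"
  shows "(\<integral>\<^sup>+\<omega>. of_nat (point_count X B \<omega>) \<partial>M) = ennreal (lam * measure lborel B)"
  by (rule poisson_mean[OF measurable_point_count[OF assms] _ prob_point_count[OF assms]])
    (use intensity_pos in simp)

lemma nn_integral_power_point_count:
  assumes "B \<in> sets borel" "bounded B" "0 \<le> z"
  shows "(\<integral>\<^sup>+\<omega>. ennreal (z ^ point_count X B \<omega>) \<partial>M) = ennreal (exp (- (lam * measure lborel B * (1 - z))))"
  by (rule poisson_pgf[OF measurable_point_count[OF assms(1,2)] _ prob_point_count[OF assms(1,2)]])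
    (use intensity_pos assms in simp_all)

lemma nn_integral_prod_counts:
  assumes C: "finite C" and A: "\<And>c. c \<in> C \<Longrightarrow> A c \<in> sets borel" "\<And>c. c \<in> C \<Longrightarrow> bounded (A c)"
    and disj: "disjoint_family_on A C"
  shows "(\<integral>\<^sup>+\<omega>. (\<Prod>c\<in>C. F c (point_count X (A c) \<omega>)) \<partial>M) =
    (\<Prod>c\<in>C. \<integral>\<^sup>+\<omega>. F c (point_count X (A c) \<omega>) \<partial>M)"
proof -
  \<comment> \<open>Independence is given for sequences of sets, so the cells are enumerated by
    \<open>h\<close> and continued by empty sets, which are disjoint from every set and from each
    other.\<close>
  obtain h where h: "bij_betw h {0..<card C} C" using ex_bij_betw_nat_finite[OF C] by blast
  define A' where "A' k = (if k < card C then A (h k) else {})" for k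
  have hC: "h k \<in> C" if "k < card C" for k
    using h that by (auto simp: bij_betw_def)
  have "A' k \<inter> A' l = {}" if "k \<noteq> l" for k l
  proof (cases "k < card C \<and> l < card C")
    case True
    then have "h k \<noteq> h l"
      using h that by (auto simp: bij_betw_def dest: inj_onD)
    then show ?thesis
      using True disjoint_family_onD[OF disj] hC by (simp add: A'_def)
  qed (auto simp: A'_def)
  then have "disjoint_family A'" by (simp add: disjoint_family_on_def)
  then have "indep_vars (\<lambda>_. count_space UNIV) (\<lambda>k. point_count X (A' k)) UNIV"
    by (rule indep_counts[rotated 2]) (use A hC in \<open>auto simp: A'_def\<close>)
  then have "indep_vars (\<lambda>_. borel) (\<lambda>k \<omega>. F (h k) (point_count X (A' k) \<omega>)) UNIV"
    by (rule indep_vars_compose2) auto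
  then have "indep_vars (\<lambda>_. borel) (\<lambda>k \<omega>. F (h k) (point_count X (A' k) \<omega>)) {0..<card C}"
    by (rule indep_vars_subset) auto
  then have "(\<integral>\<^sup>+\<omega>. (\<Prod>k\<in>{0..<card C}. F (h k) (point_count X (A' k) \<omega>)) \<partial>M) =
    (\<Prod>k\<in>{0..<card C}. \<integral>\<^sup>+\<omega>. F (h k) (point_count X (A' k) \<omega>) \<partial>M)"
    by (intro indep_vars_nn_integral) auto
  moreover have "(\<Prod>k\<in>{0..<card C}. F (h k) (point_count X (A' k) \<omega>)) =
      (\<Prod>c\<in>C. F c (point_count X (A c) \<omega>))" for \<omega>
    by (subst prod.reindex_bij_betw[OF h, symmetric]) (auto simp: A'_def intro!: prod.cong)
  moreover have "(\<Prod>k\<in>{0..<card C}. \<integral>\<^sup>+\<omega>. F (h k) (point_count X (A' k) \<omega>) \<partial>M) =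
      (\<Prod>c\<in>C. \<integral>\<^sup>+\<omega>. F c (point_count X (A c) \<omega>) \<partial>M)"
    by (subst prod.reindex_bij_betw[OF h, symmetric]) (auto simp: A'_def intro!: prod.cong)
  ultimately show ?thesis by simp
qed

lemma nn_integral_prod_cells:
  assumes C: "finite C" and A: "\<And>c. c \<in> C \<Longrightarrow> A c \<in> sets borel" "\<And>c. c \<in> C \<Longrightarrow> bounded (A c)"
    and disj: "disjoint_family_on A C" and v: "\<And>c. 0 \<le> v c"
  shows "(\<integral>\<^sup>+\<omega>. ennreal (\<Prod>c\<in>C. v c ^ point_count X (A c) \<omega>) \<partial>M) =
    ennreal (exp (- (lam * (\<Sum>c\<in>C. measure lborel (A c) * (1 - v c)))))"
proof -
  have "(\<integral>\<^sup>+\<omega>. ennreal (\<Prod>c\<in>C. v c ^ point_count X (A c) \<omega>) \<partial>M) =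
      (\<integral>\<^sup>+\<omega>. (\<Prod>c\<in>C. ennreal (v c ^ point_count X (A c) \<omega>)) \<partial>M)"
    using v by (simp add: prod_ennreal)
  also have "\<dots> = (\<Prod>c\<in>C. \<integral>\<^sup>+\<omega>. ennreal (v c ^ point_count X (A c) \<omega>) \<partial>M)"
    by (rule nn_integral_prod_counts[OF C A disj, of "\<lambda>c n. ennreal (v c ^ n)"])
  also have "\<dots> = (\<Prod>c\<in>C. ennreal (exp (- (lam * measure lborel (A c) * (1 - v c)))))"
    using A v by (intro prod.cong nn_integral_power_point_count) auto
  also have "\<dots> = ennreal (exp (\<Sum>c\<in>C. - (lam * measure lborel (A c) * (1 - v c))))"
    by (simp add: prod_ennreal exp_sum C)
  finally show ?thesis
    by (simp add: sum_negf sum_distrib_left mult.assoc)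
qed

text \<open>A discrete Mecke formula. Because \<open>v c c = 1\<close>, the count of cell
  \<open>c\<close> does not enter its own product, so the count of \<open>D c\<close> is independent
  of that product and contributes its mean, while the other cells contribute generating functions.
  In the exponent the term \<open>c' = c\<close> is 0.\<close>

lemma nn_integral_sum_cells:
  fixes A D :: "'c \<Rightarrow> (real^2) set"
  assumes C: "finite C" and A: "\<And>c. c \<in> C \<Longrightarrow> A c \<in> sets borel" "\<And>c. c \<in> C \<Longrightarrow> bounded (A c)"
    and disj: "disjoint_family_on A C" and v: "\<And>c c'. 0 \<le> v c c'" "\<And>c. v c c = 1"
    and D: "\<And>c. c \<in> C \<Longrightarrow> D c \<in> sets borel" "\<And>c. c \<in> C \<Longrightarrow> D c \<subseteq> A c"
  shows "(\<integral>\<^sup>+\<omega>. ennreal (\<Sum>c\<in>C. real (point_count X (D c) \<omega>) * (\<Prod>c'\<in>C. v c c' ^ point_count X (A c') \<omega>)) \<partial>M) =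
    ennreal (\<Sum>c\<in>C. lam * measure lborel (D c) * exp (- (lam * (\<Sum>c'\<in>C. measure lborel (A c') * (1 - v c c')))))"
proof -
  have Db: "bounded (D c)" if "c \<in> C" for c
    using A(2)[OF that] D(2)[OF that] bounded_subset by blast
  note [measurable] = measurable_point_count[OF A] measurable_point_count[OF D(1) Db]
  have one: "(\<integral>\<^sup>+\<omega>. ennreal (real (point_count X (D c) \<omega>) * (\<Prod>c'\<in>C. v c c' ^ point_count X (A c') \<omega>)) \<partial>M) =
    ennreal (lam * measure lborel (D c) * exp (- (lam * (\<Sum>c'\<in>C. measure lborel (A c') * (1 - v c c')))))"
    if c: "c \<in> C" for c
  proof -
    \<comment> \<open>Cell \<open>c\<close> is shrunk to \<open>D c\<close>, which keeps the family
      disjoint; \<open>F c\<close> reads off the count itself, and the remaining \<open>F c'\<close>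
      give generating functions.\<close>
    define A' where "A' = A(c := D c)"
    define F :: "'c \<Rightarrow> nat \<Rightarrow> ennreal"
      where "F c' n = (if c' = c then of_nat n else ennreal (v c c' ^ n))" for c' n
    have A': "A' c' \<in> sets borel" "bounded (A' c')" if "c' \<in> C" for c'
      using A D Db c that by (auto simp: A'_def)
    have "A' c' \<subseteq> A c'" if "c' \<in> C" for c'
      using D(2)[OF c] by (simp add: A'_def)
    then have disj': "disjoint_family_on A' C"
      using disj unfolding disjoint_family_on_def by blast
    have split: "(\<Prod>c'\<in>C. g c') = g c * (\<Prod>c'\<in>C - {c}. g c')" for g :: "'c \<Rightarrow> 'e :: comm_monoid_mult"
      by (rule prod.remove[OF C c])
    have "ennreal (real (point_count X (D c) \<omega>) * (\<Prod>c'\<in>C. v c c' ^ point_count X (A c') \<omega>)) =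
        (\<Prod>c'\<in>C. F c' (point_count X (A' c') \<omega>))" for \<omega>
      unfolding split using v
      by (auto simp: F_def A'_def ennreal_mult prod_nonneg ennreal_of_nat_eq_real_of_nat
          simp flip: prod_ennreal intro!: prod.cong)
    then have "(\<integral>\<^sup>+\<omega>. ennreal (real (point_count X (D c) \<omega>) * (\<Prod>c'\<in>C. v c c' ^ point_count X (A c') \<omega>)) \<partial>M) =
        (\<integral>\<^sup>+\<omega>. (\<Prod>c'\<in>C. F c' (point_count X (A' c') \<omega>)) \<partial>M)" by simp
    also have "\<dots> = (\<Prod>c'\<in>C. \<integral>\<^sup>+\<omega>. F c' (point_count X (A' c') \<omega>) \<partial>M)"
      by (rule nn_integral_prod_counts[OF C A' disj'])
    also have "\<dots> = ennreal (lam * measure lborel (D c)) *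
        (\<Prod>c'\<in>C - {c}. ennreal (exp (- (lam * measure lborel (A c') * (1 - v c c')))))"
      unfolding split using A D(1)[OF c] Db[OF c] v
      by (intro arg_cong2[where f="(*)"] prod.cong)
        (auto simp: F_def A'_def nn_integral_point_count nn_integral_power_point_count)
    \<comment> \<open>The missing factor is \<open>exp 0 = 1\<close>, so the product may run over
      all of \<open>C\<close> again.\<close>
    also have "(\<Prod>c'\<in>C - {c}. ennreal (exp (- (lam * measure lborel (A c') * (1 - v c c'))))) =
        (\<Prod>c'\<in>C. ennreal (exp (- (lam * measure lborel (A c') * (1 - v c c')))))"
      unfolding split by (simp add: v)
    also have "\<dots> = ennreal (exp (\<Sum>c'\<in>C. - (lam * measure lborel (A c') * (1 - v c c'))))"
      by (simp add: prod_ennreal exp_sum C)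
    finally show ?thesis
      using intensity_pos by (simp add: sum_negf sum_distrib_left mult.assoc ennreal_mult)
  qed
  have "(\<integral>\<^sup>+\<omega>. ennreal (\<Sum>c\<in>C. real (point_count X (D c) \<omega>) * (\<Prod>c'\<in>C. v c c' ^ point_count X (A c') \<omega>)) \<partial>M) =
    (\<integral>\<^sup>+\<omega>. (\<Sum>c\<in>C. ennreal (real (point_count X (D c) \<omega>) * (\<Prod>c'\<in>C. v c c' ^ point_count X (A c') \<omega>))) \<partial>M)"
    using v by (intro nn_integral_cong sum_ennreal[symmetric]) (auto intro!: mult_nonneg_nonneg prod_nonneg)
  also have "\<dots> = (\<Sum>c\<in>C. \<integral>\<^sup>+\<omega>. ennreal (real (point_count X (D c) \<omega>) * (\<Prod>c'\<in>C. v c c' ^ point_count X (A c') \<omega>)) \<partial>M)"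
    by (rule nn_integral_sum) measurable
  also have "\<dots> = ennreal (\<Sum>c\<in>C. lam * measure lborel (D c) * exp (- (lam * (\<Sum>c'\<in>C. measure lborel (A c') * (1 - v c c')))))"
    using intensity_pos by (simp add: one sum_ennreal)
  finally show ?thesis .
qed

end

section \<open>The Mecke and Laplace formulas\<close>

text \<open>The fibres of \<open>r n\<close> form a finite partition of the plane, with the values
  of \<open>r n\<close> as representatives. Pointwise convergence is enough: a bounded window
  contains almost surely finitely many points, and the integrals pass to the limit by
  domination.\<close>

lemma simple_approximations_of_identity:
  obtains r :: "nat \<Rightarrow> real^2 \<Rightarrow> real^2"
  where "\<And>n. r n \<in> borel_measurable borel" "\<And>n. finite (range (r n))" "\<And>x. (\<lambda>n. r n x) \<longlonglongrightarrow> x"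
proof -
  have "(\<lambda>x. x) \<in> borel_measurable (borel :: (real^2) measure)" by simp
  from borel_measurable_implies_sequence_metric[OF this, of 0]
  obtain r :: "nat \<Rightarrow> real^2 \<Rightarrow> real^2"
    where r: "\<And>n. simple_function borel (r n)" "\<And>x. (\<lambda>n. r n x) \<longlonglongrightarrow> x"
    by auto
  show thesis
  proof (rule that)
    show "r n \<in> borel_measurable borel" for n
      using r(1) by (rule borel_measurable_simple_function)
    show "finite (range (r n))" for n
      using r(1)[of n] by (simp add: simple_function_def)
  qed fact
qed

lemma integral_cells:
  fixes W :: "(real^2) set" and v :: "'c \<Rightarrow> real"
  assumes W: "W \<in> sets borel" "emeasure lborel W < \<infinity>" and C: "finite C" "range r \<subseteq> C"
    and cells: "\<And>c. c \<in> C \<Longrightarrow> W \<inter> r -` {c} \<in> sets borel"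
  shows "(LINT y|lborel. indicator W y * v (r y)) = (\<Sum>c\<in>C. measure lborel (W \<inter> r -` {c}) * v c)"
proof -
  have fin: "emeasure lborel (W \<inter> r -` {c}) < \<infinity>" if "c \<in> C" for c
    using emeasure_mono[of "W \<inter> r -` {c}" W lborel] W by (simp add: order_le_less_trans)
  have "indicator W y * v (r y) = (\<Sum>c\<in>C. indicator (W \<inter> r -` {c}) y * v c)" for y
  proof -
    have "(\<Sum>c\<in>C. indicator (W \<inter> r -` {c}) y * v c) = (\<Sum>c\<in>{r y}. indicator (W \<inter> r -` {c}) y * v c)"
      by (rule sum.mono_neutral_right) (use C in \<open>auto simp: indicator_def\<close>)
    then show ?thesis by (simp add: indicator_def)
  qed
  then have "(LINT y|lborel. indicator W y * v (r y)) = (LINT y|lborel. (\<Sum>c\<in>C. indicator (W \<inter> r -` {c}) y * v c))"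
    by simp
  also have "\<dots> = (\<Sum>c\<in>C. (LINT y|lborel. indicator (W \<inter> r -` {c}) y * v c))"
    by (rule Bochner_Integration.integral_sum) (use fin cells in \<open>auto intro!: integrable_real_indicator\<close>)
  finally show ?thesis by simp
qed

lemma measurable_cell:
  fixes r :: "real^2 \<Rightarrow> real^2"
  assumes "r \<in> borel_measurable borel" "W \<in> sets borel"
  shows "W \<inter> r -` {c} \<in> sets borel"
  using assms by (intro sets.Int) (auto intro!: measurable_sets_borel)

lemma emeasure_bounded_lt_top:
  fixes W :: "(real^2) set"
  assumes "bounded W"
  shows "emeasure lborel W < \<infinity>"
  using assms emeasure_bounded_finite by (auto simp: less_top)

context planar_poisson
begin

text \<open>Discretisation: along simple functions \<open>r n\<close> converging to the identity, the points of a
  bounded window eventually lie in different cells \<open>W \<inter> r n -` {c}\<close>, whose counts are independent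
  Poisson variables.\<close>

lemma laplace_window:
  fixes k :: "real^2 \<Rightarrow> real"
  assumes cont: "continuous_on UNIV k" and k: "\<And>x. 0 \<le> k x" "\<And>x. k x \<le> 1"
    and W: "W \<in> sets borel" "bounded W"
  shows "(\<integral>\<^sup>+\<omega>. ennreal (index_prod UNIV (\<lambda>j. if X j \<omega> \<in> W then k (X j \<omega>) else 1)) \<partial>M) =
    ennreal (exp (- (lam * (LINT y|lborel. indicator W y * (1 - k y)))))"
proof -
  obtain r :: "nat \<Rightarrow> real^2 \<Rightarrow> real^2"
    where r [measurable]: "\<And>n. r n \<in> borel_measurable borel"
      and fin: "\<And>n. finite (range (r n))" and lim: "\<And>x. (\<lambda>n. r n x) \<longlonglongrightarrow> x"
    using simple_approximations_of_identity by blast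
  have [measurable]: "k \<in> borel_measurable borel"
    by (rule borel_measurable_continuous_onI[OF cont])
  have [measurable]: "W \<in> sets borel" by fact
  define A where "A n c = W \<inter> r n -` {c}" for n c
  have A: "A n c \<in> sets borel" "bounded (A n c)" for n c
    using measurable_cell[OF r W(1)] bounded_subset[OF W(2)] by (auto simp: A_def)
  note [measurable] = measurable_point_count[OF A]
  \<comment> \<open>The kernel is evaluated at the representative of each cell, so
    \<open>T n \<omega>\<close> is the product of \<open>k (r n (X j \<omega>))\<close> over the
    points in \<open>W\<close>.\<close>
  define T where "T n \<omega> = (\<Prod>c\<in>range (r n). k c ^ point_count X (A n c) \<omega>)" for n \<omega>
  have T: "(\<integral>\<^sup>+\<omega>. ennreal (T n \<omega>) \<partial>M) = ennreal (exp (- (lam * (LINT y|lborel. indicator W y * (1 - k (r n y))))))" for n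
  proof -
    have "(LINT y|lborel. indicator W y * (1 - k (r n y))) = (\<Sum>c\<in>range (r n). measure lborel (A n c) * (1 - k c))"
      unfolding A_def using integral_cells[of W "range (r n)" "r n" "\<lambda>c. 1 - k c"] W fin A emeasure_bounded_lt_top[OF W(2)]
      by (auto simp: A_def)
    moreover have "disjoint_family_on (A n) (range (r n))"
      by (auto simp: disjoint_family_on_def A_def)
    ultimately show ?thesis
      unfolding T_def using fin A k by (simp add: nn_integral_prod_cells)
  qed
  have kr: "(\<lambda>n. k (r n x)) \<longlonglongrightarrow> k x" for x
    using lim[of x] cont by (simp add: continuous_on_tendsto_compose[of UNIV k])
  have "(\<lambda>n. \<integral>\<^sup>+\<omega>. ennreal (T n \<omega>) \<partial>M) \<longlonglongrightarrow>
    (\<integral>\<^sup>+\<omega>. ennreal (index_prod UNIV (\<lambda>j. if X j \<omega> \<in> W then k (X j \<omega>) else 1)) \<partial>M)"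
  proof (rule nn_integral_dominated_convergence[where w = "\<lambda>_. 1"])
    show "(\<lambda>\<omega>. ennreal (T n \<omega>)) \<in> borel_measurable M" for n
      unfolding T_def by measurable
    show "AE \<omega> in M. ennreal (T n \<omega>) \<le> 1" for n
      unfolding T_def using k by (intro AE_I2) (auto intro!: prod_le_1 power_le_one)
    show "AE \<omega> in M. (\<lambda>n. ennreal (T n \<omega>)) \<longlonglongrightarrow>
        ennreal (index_prod UNIV (\<lambda>j. if X j \<omega> \<in> W then k (X j \<omega>) else 1))"
      using AE_finite[OF W(2)]
    proof eventually_elim
      case (elim \<omega>)
      define J where "J = {j. X j \<omega> \<in> W}"
      have "point_count X (A n c) \<omega> = card {j\<in>J. r n (X j \<omega>) = c}" for n c
        unfolding point_count_def A_def J_def by (intro arg_cong[where f=card]) auto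
      then have "T n \<omega> = (\<Prod>j\<in>J. k (r n (X j \<omega>)))" for n
        using prod_fibres[of J "range (r n)" "\<lambda>j. r n (X j \<omega>)" k] elim fin by (auto simp: T_def J_def)
      moreover have "(\<lambda>n. \<Prod>j\<in>J. k (r n (X j \<omega>))) \<longlonglongrightarrow> (\<Prod>j\<in>J. k (X j \<omega>))"
        by (intro tendsto_prod kr)
      moreover have "index_prod UNIV (\<lambda>j. if X j \<omega> \<in> W then k (X j \<omega>) else 1) = (\<Prod>j\<in>J. k (X j \<omega>))"
        using elim by (subst index_prod_eq_prod[of J]) (auto simp: J_def)
      ultimately show ?case by (intro tendsto_ennrealI) simp
    qed
  qed (auto simp: emeasure_space_1)
  moreover have "(\<lambda>n. \<integral>\<^sup>+\<omega>. ennreal (T n \<omega>) \<partial>M) \<longlonglongrightarrow>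
      ennreal (exp (- (lam * (LINT y|lborel. indicator W y * (1 - k y)))))"
    unfolding T
  proof (intro tendsto_ennrealI tendsto_exp tendsto_minus tendsto_mult tendsto_const)
    show "(\<lambda>n. LINT y|lborel. indicator W y * (1 - k (r n y))) \<longlonglongrightarrow> (LINT y|lborel. indicator W y * (1 - k y))"
    proof (rule integral_dominated_convergence[where w = "indicator W"])
      show "AE y in lborel. norm (indicator W y * (1 - k (r n y))) \<le> indicator W y" for n
        using k by (intro AE_I2) (auto simp: indicator_def)
      show "AE y in lborel. (\<lambda>n. indicator W y * (1 - k (r n y))) \<longlonglongrightarrow> indicator W y * (1 - k y)"
        by (intro AE_I2 tendsto_intros kr)
    qed (use emeasure_bounded_lt_top[OF W(2)] in \<open>auto intro!: integrable_real_indicator\<close>)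
  qed
  ultimately show ?thesis by (rule LIMSEQ_unique)
qed

text \<open>Mecke's formula as a limit of \<open>nn_integral_sum_cells\<close>. At the level of
  cells a point can only be excluded together with its whole cell. Since the points are almost
  surely distinct, eventually no other point of the window shares that cell, and what is excluded is
  exactly the point itself.\<close>

lemma mecke_window:
  fixes k :: "real^2 \<Rightarrow> real^2 \<Rightarrow> real"
  assumes cont: "continuous_on UNIV (\<lambda>p. k (fst p) (snd p))" and k: "\<And>x y. 0 \<le> k x y" "\<And>x y. k x y \<le> 1"
    and W: "W \<in> sets borel" "bounded W" and B: "B \<in> sets borel" "B \<subseteq> W"
  shows "(\<integral>\<^sup>+\<omega>. (\<Sum>i. indicator B (X i \<omega>) *
            ennreal (index_prod (- {i}) (\<lambda>j. if X j \<omega> \<in> W then k (X i \<omega>) (X j \<omega>) else 1))) \<partial>M) =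
    (\<integral>\<^sup>+x. indicator B x * ennreal (lam * exp (- (lam * (LINT y|lborel. indicator W y * (1 - k x y))))) \<partial>lborel)"
proof -
  obtain r :: "nat \<Rightarrow> real^2 \<Rightarrow> real^2"
    where r [measurable]: "\<And>n. r n \<in> borel_measurable borel"
      and fin: "\<And>n. finite (range (r n))" and lim: "\<And>x. (\<lambda>n. r n x) \<longlonglongrightarrow> x"
    using simple_approximations_of_identity by blast
  have k_meas: "(\<lambda>p. k (fst p) (snd p)) \<in> borel_measurable (borel \<Otimes>\<^sub>M borel)"
    unfolding borel_prod by (rule borel_measurable_continuous_onI[OF cont])
  have [measurable]: "(\<lambda>w. k (f w) (g w)) \<in> borel_measurable N"
    if [measurable]: "f \<in> borel_measurable N" "g \<in> borel_measurable N" for f g and N :: "'z measure"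
    using measurable_compose[OF _ k_meas, of "\<lambda>w. (f w, g w)" N] by simp
  have [measurable]: "W \<in> sets borel" "B \<in> sets borel" by fact+
  have Bb: "bounded B" using B W bounded_subset by blast
  \<comment> \<open>Counts do not distinguish the points of one cell. Setting the kernel to 1 at
    equal representatives removes the cell of the typical point from the product and provides the
    condition \<open>v c c = 1\<close>.\<close>
  define kk where "kk c c' = (if c' = c then 1 else k c c')" for c c'
  have kk: "0 \<le> kk c c'" "kk c c' \<le> 1" for c c' using k by (auto simp: kk_def)
  define A where "A n c = W \<inter> r n -` {c}" for n c
  \<comment> \<open>The typical point is counted in \<open>B\<close>, while its partners range over
    \<open>W\<close>; hence two families of cells with the same representatives.\<close>
  define D where "D n c = B \<inter> r n -` {c}" for n c
  have A: "A n c \<in> sets borel" "bounded (A n c)" for n c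
    using measurable_cell[OF r W(1)] bounded_subset[OF W(2)] by (auto simp: A_def)
  have D: "D n c \<in> sets borel" "bounded (D n c)" "D n c \<subseteq> A n c" for n c
    using measurable_cell[OF r B(1)] bounded_subset[OF Bb] B(2) by (auto simp: A_def D_def)
  note [measurable] = measurable_point_count[OF A] measurable_point_count[OF D(1,2)]
  define S where "S n \<omega> = (\<Sum>c\<in>range (r n). real (point_count X (D n c) \<omega>) *
      (\<Prod>c'\<in>range (r n). kk c c' ^ point_count X (A n c') \<omega>))" for n \<omega>
  define q where "q n x = (LINT y|lborel. indicator W y * (1 - kk (r n x) (r n y)))" for n x
  have q_cells: "q n x = (\<Sum>c'\<in>range (r n). measure lborel (A n c') * (1 - kk (r n x) c'))" for n x
    unfolding q_def A_def using integral_cells[of W "range (r n)" "r n" "\<lambda>c. 1 - kk (r n x) c"] W fin A emeasure_bounded_lt_top[OF W(2)]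
    by (auto simp: A_def)
  have [measurable]: "q n \<in> borel_measurable borel" for n
    unfolding q_cells kk_def by measurable
  have S: "(\<integral>\<^sup>+\<omega>. ennreal (S n \<omega>) \<partial>M) = (\<integral>\<^sup>+x. indicator B x * ennreal (lam * exp (- (lam * q n x))) \<partial>lborel)" for n
  proof -
    have "disjoint_family_on (A n) (range (r n))"
      by (auto simp: disjoint_family_on_def A_def)
    then have "(\<integral>\<^sup>+\<omega>. ennreal (S n \<omega>) \<partial>M) = ennreal (\<Sum>c\<in>range (r n). lam * measure lborel (D n c) *
        exp (- (lam * (\<Sum>c'\<in>range (r n). measure lborel (A n c') * (1 - kk c c')))))"
      unfolding S_def using A D fin kk
      by (intro nn_integral_sum_cells) (auto simp: kk_def)
    also have "(\<Sum>c\<in>range (r n). lam * measure lborel (D n c) *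
        exp (- (lam * (\<Sum>c'\<in>range (r n). measure lborel (A n c') * (1 - kk c c'))))) =
        (\<Sum>c\<in>range (r n). measure lborel (D n c) *
        (lam * exp (- (lam * (\<Sum>c'\<in>range (r n). measure lborel (A n c') * (1 - kk c c'))))))"
      by (simp add: ac_simps)
    \<comment> \<open>The exponential depends on \<open>x\<close> only through \<open>r n x\<close>,
      so the sum over cells is the integral of a step function over \<open>B\<close>.\<close>
    also have "\<dots> = (LINT x|lborel. indicator B x * (lam * exp (- (lam * q n x))))"
      unfolding D_def q_cells
      by (subst integral_cells[of B "range (r n)" "r n" "\<lambda>c. lam * exp (- (lam * (\<Sum>c'\<in>range (r n). measure lborel (A n c') * (1 - kk c c'))))", symmetric])
        (use B fin D emeasure_bounded_lt_top[OF Bb] in \<open>auto simp: D_def\<close>)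
    also have "ennreal \<dots> = (\<integral>\<^sup>+x. ennreal (indicator B x * (lam * exp (- (lam * q n x)))) \<partial>lborel)"
    proof (rule nn_integral_eq_integral[symmetric])
      have "integrable lborel (\<lambda>x. indicator B x *\<^sub>R (lam * exp (- (lam * q n x))))"
      proof (rule integrableI_bounded_set_indicator[where B=lam])
        show "AE x in lborel. x \<in> B \<longrightarrow> norm (lam * exp (- (lam * q n x))) \<le> lam"
        proof (intro AE_I2 impI)
          fix x
          have "0 \<le> q n x" unfolding q_def by (rule Bochner_Integration.integral_nonneg) (use kk in auto)
          then show "norm (lam * exp (- (lam * q n x))) \<le> lam"
            using intensity_pos by (simp add: abs_mult mult_le_cancel_left1)
        qed
      qed (use emeasure_bounded_lt_top[OF Bb] in auto)
      then show "integrable lborel (\<lambda>x. indicator B x * (lam * exp (- (lam * q n x))))" by simp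
    qed (use intensity_pos in auto)
    finally show ?thesis
      using intensity_pos by (simp add: ennreal_mult ennreal_indicator)
  qed
  \<comment> \<open>Distinct points eventually have distinct representatives, so the modification of
    the kernel disappears and continuity of \<open>k\<close> gives the limit.\<close>
  have kr: "(\<lambda>n. kk (r n x) (r n y)) \<longlonglongrightarrow> k x y" if "y \<noteq> x" for x y
  proof -
    have "(\<lambda>n. r n y - r n x) \<longlonglongrightarrow> y - x" by (intro tendsto_diff lim)
    then have "eventually (\<lambda>n. r n y - r n x \<noteq> 0) sequentially"
      using that by (intro tendsto_imp_eventually_ne) auto
    then have ev: "eventually (\<lambda>n. k (r n x) (r n y) = kk (r n x) (r n y)) sequentially"
      by eventually_elim (auto simp: kk_def)
    have "(\<lambda>n. (r n x, r n y)) \<longlonglongrightarrow> (x, y)" by (intro tendsto_Pair lim)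
    with cont have "(\<lambda>n. k (r n x) (r n y)) \<longlonglongrightarrow> k x y"
      using continuous_on_tendsto_compose[OF cont, of "\<lambda>n. (r n x, r n y)" "(x, y)" sequentially] by simp
    then show ?thesis using ev by (rule Lim_transform_eventually)
  qed
  have "(\<lambda>n. \<integral>\<^sup>+\<omega>. ennreal (S n \<omega>) \<partial>M) \<longlonglongrightarrow>
    (\<integral>\<^sup>+\<omega>. (\<Sum>i. indicator B (X i \<omega>) *
            ennreal (index_prod (- {i}) (\<lambda>j. if X j \<omega> \<in> W then k (X i \<omega>) (X j \<omega>) else 1))) \<partial>M)"
  \<comment> \<open>Each point of \<open>B\<close> contributes at most 1, and the number of these
    points has finite mean.\<close>
  proof (rule nn_integral_dominated_convergence[where w = "\<lambda>\<omega>. of_nat (point_count X B \<omega>)"])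
    show "(\<lambda>\<omega>. ennreal (S n \<omega>)) \<in> borel_measurable M" for n
      unfolding S_def by measurable
    show "(\<lambda>\<omega>. of_nat (point_count X B \<omega>)) \<in> borel_measurable M"
      using measurable_point_count[OF B(1) Bb] by measurable
    show "(\<integral>\<^sup>+\<omega>. of_nat (point_count X B \<omega>) \<partial>M) < \<infinity>"
      by (simp add: nn_integral_point_count[OF B(1) Bb])
    have S_eq: "AE \<omega> in M. \<forall>n. S n \<omega> = (\<Sum>i | X i \<omega> \<in> B. \<Prod>j | X j \<omega> \<in> W. kk (r n (X i \<omega>)) (r n (X j \<omega>)))"
      using AE_finite[OF W(2)]
    proof eventually_elim
      case (elim \<omega>)
      define I where "I = {i. X i \<omega> \<in> B}"
      define J where "J = {j. X j \<omega> \<in> W}"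
      have finJ: "finite J" and finI: "finite I"
        using elim B(2) by (auto simp: I_def J_def intro: rev_finite_subset)
      have "point_count X (A n c) \<omega> = card {j\<in>J. r n (X j \<omega>) = c}"
           "point_count X (D n c) \<omega> = card {j\<in>I. r n (X j \<omega>) = c}" for n c
        unfolding point_count_def A_def D_def J_def I_def by (auto intro!: arg_cong[where f=card])
      then have "S n \<omega> = (\<Sum>c\<in>range (r n). real (card {i\<in>I. r n (X i \<omega>) = c}) *
          (\<Prod>j\<in>J. kk c (r n (X j \<omega>))))" for n
        using prod_fibres[of J "range (r n)" "\<lambda>j. r n (X j \<omega>)" "kk c" for c, OF finJ fin]
        by (simp add: S_def image_subset_iff)
      then show ?case
        using sum_fibres[of I "range (r n)" "\<lambda>i. r n (X i \<omega>)" "\<lambda>c. \<Prod>j\<in>J. kk c (r n (X j \<omega>))" for n] finI fin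
        by (auto simp: I_def J_def)
    qed
    show "AE \<omega> in M. ennreal (S n \<omega>) \<le> of_nat (point_count X B \<omega>)" for n
      using S_eq
    proof eventually_elim
      case (elim \<omega>)
      have "S n \<omega> \<le> (\<Sum>i | X i \<omega> \<in> B. 1)"
        unfolding elim[rule_format] using kk by (intro sum_mono prod_le_1) auto
      then show ?case by (simp add: point_count_def ennreal_of_nat_eq_real_of_nat)
    qed
    show "AE \<omega> in M. (\<lambda>n. ennreal (S n \<omega>)) \<longlonglongrightarrow> (\<Sum>i. indicator B (X i \<omega>) *
            ennreal (index_prod (- {i}) (\<lambda>j. if X j \<omega> \<in> W then k (X i \<omega>) (X j \<omega>) else 1)))"
      using S_eq AE_finite[OF W(2)] AE_inj
    proof eventually_elim
      case (elim \<omega>)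
      define I where "I = {i. X i \<omega> \<in> B}"
      define J where "J = {j. X j \<omega> \<in> W}"
      have finJ: "finite J" and finI: "finite I"
        using elim B(2) by (auto simp: I_def J_def intro: rev_finite_subset)
      \<comment> \<open>For \<open>j = i\<close> the representatives always coincide and the factor
        is constantly 1; this becomes the omission of \<open>i\<close> in
        \<open>index_prod (- {i})\<close>. For \<open>j \<noteq> i\<close> the two points differ by
        injectivity.\<close>
      have "(\<lambda>n. kk (r n (X i \<omega>)) (r n (X j \<omega>))) \<longlonglongrightarrow> (if j = i then 1 else k (X i \<omega>) (X j \<omega>))" for i j
        using kr[of "X j \<omega>" "X i \<omega>"] elim(3) by (auto simp: kk_def dest: injD)
      then have "(\<lambda>n. S n \<omega>) \<longlonglongrightarrow> (\<Sum>i\<in>I. \<Prod>j\<in>J. if j = i then 1 else k (X i \<omega>) (X j \<omega>))"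
        unfolding elim(1)[rule_format] I_def[symmetric] J_def[symmetric]
        by (intro tendsto_sum tendsto_prod)
      moreover have "(\<Prod>j\<in>J. if j = i then 1 else k (X i \<omega>) (X j \<omega>)) =
          index_prod (- {i}) (\<lambda>j. if X j \<omega> \<in> W then k (X i \<omega>) (X j \<omega>) else 1)" for i
      proof -
        have "(\<Prod>j\<in>J. if j = i then 1 else k (X i \<omega>) (X j \<omega>)) = (\<Prod>j\<in>J - {i}. k (X i \<omega>) (X j \<omega>))"
          using finJ by (intro prod.mono_neutral_cong_right) auto
        also have "\<dots> = index_prod (- {i}) (\<lambda>j. if X j \<omega> \<in> W then k (X i \<omega>) (X j \<omega>) else 1)"
          using finJ by (subst index_prod_eq_prod[of "J - {i}"]) (auto simp: J_def)
        finally show ?thesis .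
      qed
      ultimately have "(\<lambda>n. ennreal (S n \<omega>)) \<longlonglongrightarrow> ennreal (\<Sum>i\<in>I.
          index_prod (- {i}) (\<lambda>j. if X j \<omega> \<in> W then k (X i \<omega>) (X j \<omega>) else 1))"
        by (intro tendsto_ennrealI) simp
      also have "ennreal (\<Sum>i\<in>I. index_prod (- {i}) (\<lambda>j. if X j \<omega> \<in> W then k (X i \<omega>) (X j \<omega>) else 1)) =
          (\<Sum>i\<in>I. ennreal (index_prod (- {i}) (\<lambda>j. if X j \<omega> \<in> W then k (X i \<omega>) (X j \<omega>) else 1)))"
        using k by (intro sum_ennreal[symmetric] index_prod_nonneg) auto
      also have "\<dots> = (\<Sum>i. indicator B (X i \<omega>) *
            ennreal (index_prod (- {i}) (\<lambda>j. if X j \<omega> \<in> W then k (X i \<omega>) (X j \<omega>) else 1)))"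
        using finI by (subst suminf_finite[of I]) (auto simp: I_def)
      finally show ?case .
    qed
  qed measurable
  moreover have "(\<lambda>n. \<integral>\<^sup>+\<omega>. ennreal (S n \<omega>) \<partial>M) \<longlonglongrightarrow>
    (\<integral>\<^sup>+x. indicator B x * ennreal (lam * exp (- (lam * (LINT y|lborel. indicator W y * (1 - k x y))))) \<partial>lborel)"
    unfolding S
  proof (rule nn_integral_dominated_convergence[where w = "\<lambda>x. ennreal lam * indicator B x"])
    show "(\<integral>\<^sup>+x. ennreal lam * indicator B x \<partial>lborel) < \<infinity>"
      using emeasure_bounded_lt_top[OF Bb] by (simp add: nn_integral_cmult_indicator ennreal_mult_less_top)
    have "0 \<le> q n x" for n x unfolding q_def by (rule Bochner_Integration.integral_nonneg) (use kk in auto)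
    then show "AE x in lborel. indicator B x * ennreal (lam * exp (- (lam * q n x))) \<le> ennreal lam * indicator B x" for n
      using intensity_pos by (intro AE_I2) (auto simp: indicator_def mult_le_cancel_left1 intro!: ennreal_leI)
    have "(\<lambda>n. q n x) \<longlonglongrightarrow> (LINT y|lborel. indicator W y * (1 - k x y))" for x
      unfolding q_def
    proof (rule integral_dominated_convergence[where w = "indicator W"])
      show "AE y in lborel. norm (indicator W y * (1 - kk (r n x) (r n y))) \<le> indicator W y" for n
        using kk by (intro AE_I2) (auto simp: indicator_def)
      \<comment> \<open>On the deterministic side the diagonal is a single point and therefore a
        null set.\<close>
      have "AE y in lborel. y \<noteq> x" by (rule AE_lborel_singleton)
      then show "AE y in lborel. (\<lambda>n. indicator W y * (1 - kk (r n x) (r n y))) \<longlonglongrightarrow> indicator W y * (1 - k x y)"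
        by eventually_elim (intro tendsto_intros kr)
      show "(\<lambda>y. indicator W y * (1 - kk (r n x) (r n y))) \<in> borel_measurable lborel" for n
        unfolding kk_def by measurable
      show "(\<lambda>y. indicator W y * (1 - k x y)) \<in> borel_measurable lborel"
        by measurable
    qed (use emeasure_bounded_lt_top[OF W(2)] in \<open>auto intro!: integrable_real_indicator\<close>)
    then show "AE x in lborel. (\<lambda>n. indicator B x * ennreal (lam * exp (- (lam * q n x)))) \<longlonglongrightarrow>
      indicator B x * ennreal (lam * exp (- (lam * (LINT y|lborel. indicator W y * (1 - k x y)))))"
      by (intro AE_I2 ennreal_tendsto_cmult tendsto_ennrealI tendsto_intros) (auto simp: indicator_def)
    show "(\<lambda>x. indicator B x * ennreal (lam * exp (- (lam * (LINT y|lborel. indicator W y * (1 - k x y)))))) \<in> borel_measurable lborel"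
      by measurable
  qed measurable
  ultimately show ?thesis by (rule LIMSEQ_unique)
qed

end

section \<open>From bounded windows to the whole plane\<close>

lemma eventually_mem_cball:
  fixes x :: "real^2"
  shows "eventually (\<lambda>m. x \<in> cball 0 (real m)) sequentially"
proof -
  obtain N :: nat where "norm x \<le> real N" using real_arch_simple by blast
  then show ?thesis
    by (auto simp: eventually_sequentially intro!: exI[of _ N])
qed

lemma integral_window_tendsto:
  fixes f :: "real^2 \<Rightarrow> real"
  assumes "integrable lborel f"
  shows "(\<lambda>m. LINT y|lborel. indicator (cball 0 (real m)) y * f y) \<longlonglongrightarrow> (LINT y|lborel. f y)"
proof (rule integral_dominated_convergence[where w = "\<lambda>y. norm (f y)"])
  show "AE y in lborel. (\<lambda>m. indicator (cball 0 (real m)) y * f y) \<longlonglongrightarrow> f y"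
  proof (intro AE_I2 tendsto_eventually)
    fix y
    show "eventually (\<lambda>m. indicator (cball 0 (real m)) y * f y = f y) sequentially"
      using eventually_mem_cball[of y] by eventually_elim simp
  qed
qed (use assms in \<open>auto simp: indicator_def\<close>)

context planar_poisson
begin

text \<open>The window exhausts the plane through balls. On the left the products are bounded by 1
  and converge by \<open>index_prod_tendsto\<close>; on the right the exponent converges because
  \<open>1 - k\<close> is integrable.\<close>

theorem laplace:
  fixes k :: "real^2 \<Rightarrow> real"
  assumes cont: "continuous_on UNIV k" and k: "\<And>x. 0 \<le> k x" "\<And>x. k x \<le> 1"
    and int: "integrable lborel (\<lambda>y. 1 - k y)"
  shows "(\<integral>\<^sup>+\<omega>. ennreal (index_prod UNIV (\<lambda>j. k (X j \<omega>))) \<partial>M) =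
    ennreal (exp (- (lam * (LINT y|lborel. 1 - k y))))"
proof (rule LIMSEQ_unique)
  have [measurable]: "k \<in> borel_measurable borel"
    by (rule borel_measurable_continuous_onI[OF cont])
  let ?W = "\<lambda>m. cball 0 (real m) :: (real^2) set"
  let ?F = "\<lambda>m \<omega>. index_prod UNIV (\<lambda>j. if X j \<omega> \<in> ?W m then k (X j \<omega>) else 1)"
  show "(\<lambda>m. \<integral>\<^sup>+\<omega>. ennreal (?F m \<omega>) \<partial>M) \<longlonglongrightarrow> (\<integral>\<^sup>+\<omega>. ennreal (index_prod UNIV (\<lambda>j. k (X j \<omega>))) \<partial>M)"
  proof (rule nn_integral_dominated_convergence[where w = "\<lambda>_. 1"])
    show "AE \<omega> in M. ennreal (?F m \<omega>) \<le> 1" for m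
      using k by (auto intro!: index_prod_le_1)
    show "AE \<omega> in M. (\<lambda>m. ennreal (?F m \<omega>)) \<longlonglongrightarrow> ennreal (index_prod UNIV (\<lambda>j. k (X j \<omega>)))"
    proof (intro AE_I2 tendsto_ennrealI index_prod_tendsto)
      fix \<omega> j
      show "eventually (\<lambda>m. (if X j \<omega> \<in> ?W m then k (X j \<omega>) else 1) = k (X j \<omega>)) sequentially"
        using eventually_mem_cball[of "X j \<omega>"] by eventually_elim simp
    qed (use k in auto)
  qed (auto simp: emeasure_space_1)
  show "(\<lambda>m. \<integral>\<^sup>+\<omega>. ennreal (?F m \<omega>) \<partial>M) \<longlonglongrightarrow> ennreal (exp (- (lam * (LINT y|lborel. 1 - k y))))"
    by (subst laplace_window[OF cont k])
      (auto intro!: tendsto_ennrealI tendsto_intros integral_window_tendsto int)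
qed

text \<open>The observation window \<open>B\<close> stays fixed, and only the window of interaction
  grows to the plane. A bounded \<open>B\<close> has a count with finite mean, which serves as the
  dominating function.\<close>

lemma mecke_bounded:
  fixes k :: "real^2 \<Rightarrow> real^2 \<Rightarrow> real"
  assumes cont: "continuous_on UNIV (\<lambda>p. k (fst p) (snd p))" and k: "\<And>x y. 0 \<le> k x y" "\<And>x y. k x y \<le> 1"
    and int: "\<And>x. integrable lborel (\<lambda>y. 1 - k x y)"
    and B: "B \<in> sets borel" "bounded B"
  shows "(\<integral>\<^sup>+\<omega>. (\<Sum>i. indicator B (X i \<omega>) * ennreal (index_prod (- {i}) (\<lambda>j. k (X i \<omega>) (X j \<omega>)))) \<partial>M) =
    (\<integral>\<^sup>+x. indicator B x * ennreal (lam * exp (- (lam * (LINT y|lborel. 1 - k x y)))) \<partial>lborel)"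
proof (rule LIMSEQ_unique)
  have k_meas: "(\<lambda>p. k (fst p) (snd p)) \<in> borel_measurable (borel \<Otimes>\<^sub>M borel)"
    unfolding borel_prod by (rule borel_measurable_continuous_onI[OF cont])
  have km [measurable]: "(\<lambda>w. k (f w) (g w)) \<in> borel_measurable N"
    if [measurable]: "f \<in> borel_measurable N" "g \<in> borel_measurable N" for f g and N :: "'z measure"
    using measurable_compose[OF _ k_meas, of "\<lambda>w. (f w, g w)" N] by simp
  have [measurable]: "B \<in> sets borel" "\<And>m. cball (0 :: real^2) (real m) \<in> sets borel" using B by auto
  have [measurable]: "(\<lambda>\<omega>. index_prod (- {i}) (\<lambda>j. k (X i \<omega>) (X j \<omega>))) \<in> borel_measurable M" for i
    by (intro borel_measurable_index_prod km measurable_point)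
  let ?W = "\<lambda>m. cball 0 (real m) :: (real^2) set"
  let ?p = "\<lambda>m \<omega> i. index_prod (- {i}) (\<lambda>j. if X j \<omega> \<in> ?W m then k (X i \<omega>) (X j \<omega>) else 1)"
  let ?F = "\<lambda>m \<omega>. \<Sum>i. indicator B (X i \<omega>) * ennreal (?p m \<omega> i)"
  show "(\<lambda>m. \<integral>\<^sup>+\<omega>. ?F m \<omega> \<partial>M) \<longlonglongrightarrow>
      (\<integral>\<^sup>+\<omega>. (\<Sum>i. indicator B (X i \<omega>) * ennreal (index_prod (- {i}) (\<lambda>j. k (X i \<omega>) (X j \<omega>)))) \<partial>M)"
  proof (rule nn_integral_dominated_convergence[where w = "\<lambda>\<omega>. of_nat (point_count X B \<omega>)"])
    show "(\<lambda>\<omega>. of_nat (point_count X B \<omega>)) \<in> borel_measurable M"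
      using measurable_point_count[OF B] by measurable
    show "(\<integral>\<^sup>+\<omega>. of_nat (point_count X B \<omega>) \<partial>M) < \<infinity>"
      by (simp add: nn_integral_point_count[OF B])
    have sum_eq: "(\<Sum>i. indicator B (X i \<omega>) * f i) = (\<Sum>i | X i \<omega> \<in> B. f i)"
      if "finite {i. X i \<omega> \<in> B}" for \<omega> and f :: "nat \<Rightarrow> ennreal"
      using that by (subst suminf_finite[of "{i. X i \<omega> \<in> B}"]) auto
    show "AE \<omega> in M. ?F m \<omega> \<le> of_nat (point_count X B \<omega>)" for m
      using AE_finite[OF B(2)]
    proof eventually_elim
      case (elim \<omega>)
      have "?F m \<omega> \<le> (\<Sum>i | X i \<omega> \<in> B. 1)"
        unfolding sum_eq[OF elim] using k
        by (intro sum_mono) (auto intro!: index_prod_le_1 split: if_splits)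
      then show ?case by (simp add: point_count_def)
    qed
    show "AE \<omega> in M. (\<lambda>m. ?F m \<omega>) \<longlonglongrightarrow>
        (\<Sum>i. indicator B (X i \<omega>) * ennreal (index_prod (- {i}) (\<lambda>j. k (X i \<omega>) (X j \<omega>))))"
      using AE_finite[OF B(2)]
    proof eventually_elim
      case (elim \<omega>)
      show ?case
        unfolding sum_eq[OF elim]
      proof (intro tendsto_sum tendsto_ennrealI index_prod_tendsto)
        fix i j
        show "eventually (\<lambda>m. (if X j \<omega> \<in> ?W m then k (X i \<omega>) (X j \<omega>) else 1) = k (X i \<omega>) (X j \<omega>)) sequentially"
          using eventually_mem_cball[of "X j \<omega>"] by eventually_elim simp
      qed (use k in auto)
    qed
  qed measurable
  \<comment> \<open>\<open>mecke_window\<close> requires the ball to contain \<open>B\<close>, so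
    the identity holds only from some radius on.\<close>
  have "eventually (\<lambda>m. (\<integral>\<^sup>+x. indicator B x * ennreal (lam * exp (- (lam * (LINT y|lborel. indicator (?W m) y * (1 - k x y))))) \<partial>lborel) =
      (\<integral>\<^sup>+\<omega>. ?F m \<omega> \<partial>M)) sequentially"
  proof -
    obtain N :: nat where "\<And>x. x \<in> B \<Longrightarrow> norm x \<le> real N"
      using B(2) unfolding bounded_iff by (meson order_trans real_arch_simple)
    then have sub: "B \<subseteq> ?W m" if "m \<ge> N" for m using that by (fastforce simp: subset_iff)
    show ?thesis
      by (rule eventually_sequentiallyI[of N], rule mecke_window[OF cont k, symmetric])
        (use sub B in simp_all)
  qed
  moreover have "(\<lambda>m. \<integral>\<^sup>+x. indicator B x * ennreal (lam * exp (- (lam * (LINT y|lborel. indicator (?W m) y * (1 - k x y))))) \<partial>lborel)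
      \<longlonglongrightarrow> (\<integral>\<^sup>+x. indicator B x * ennreal (lam * exp (- (lam * (LINT y|lborel. 1 - k x y)))) \<partial>lborel)"
  proof (rule nn_integral_dominated_convergence[where w = "\<lambda>x. ennreal lam * indicator B x"])
    show "(\<integral>\<^sup>+x. ennreal lam * indicator B x \<partial>lborel) < \<infinity>"
      using emeasure_bounded_lt_top[OF B(2)] by (simp add: nn_integral_cmult_indicator ennreal_mult_less_top)
    have "0 \<le> (LINT y|lborel. indicator (?W m) y * (1 - k x y))" for m x
      by (rule Bochner_Integration.integral_nonneg) (use k in auto)
    then show "AE x in lborel. indicator B x * ennreal (lam * exp (- (lam * (LINT y|lborel. indicator (?W m) y * (1 - k x y)))))
        \<le> ennreal lam * indicator B x" for m
      using intensity_pos by (intro AE_I2) (auto simp: indicator_def mult_le_cancel_left1 intro!: ennreal_leI)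
    show "AE x in lborel. (\<lambda>m. indicator B x * ennreal (lam * exp (- (lam * (LINT y|lborel. indicator (?W m) y * (1 - k x y))))))
      \<longlonglongrightarrow> indicator B x * ennreal (lam * exp (- (lam * (LINT y|lborel. 1 - k x y))))"
      by (intro AE_I2 ennreal_tendsto_cmult tendsto_ennrealI tendsto_intros integral_window_tendsto int)
        (auto simp: indicator_def)
  qed measurable
  ultimately show "(\<lambda>m. \<integral>\<^sup>+\<omega>. ?F m \<omega> \<partial>M)
      \<longlonglongrightarrow> (\<integral>\<^sup>+x. indicator B x * ennreal (lam * exp (- (lam * (LINT y|lborel. 1 - k x y)))) \<partial>lborel)"
    by (rule Lim_transform_eventually[rotated])
qed

text \<open>A window of finite area may be unbounded, and the law of the counts is given for bounded
  sets only. The passage from \<open>B \<inter> cball 0 m\<close> to \<open>B\<close> therefore uses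
  monotone convergence; the product attached to a point does not involve the window.\<close>

theorem mecke:
  fixes k :: "real^2 \<Rightarrow> real^2 \<Rightarrow> real"
  assumes cont: "continuous_on UNIV (\<lambda>p. k (fst p) (snd p))" and k: "\<And>x y. 0 \<le> k x y" "\<And>x y. k x y \<le> 1"
    and int: "\<And>x. integrable lborel (\<lambda>y. 1 - k x y)"
    and B: "B \<in> sets borel"
  shows "(\<integral>\<^sup>+\<omega>. (\<Sum>i. indicator B (X i \<omega>) * ennreal (index_prod (- {i}) (\<lambda>j. k (X i \<omega>) (X j \<omega>)))) \<partial>M) =
    (\<integral>\<^sup>+x. indicator B x * ennreal (lam * exp (- (lam * (LINT y|lborel. 1 - k x y)))) \<partial>lborel)"
proof -
  have k_meas: "(\<lambda>p. k (fst p) (snd p)) \<in> borel_measurable (borel \<Otimes>\<^sub>M borel)"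
    unfolding borel_prod by (rule borel_measurable_continuous_onI[OF cont])
  have km [measurable]: "(\<lambda>w. k (f w) (g w)) \<in> borel_measurable N"
    if [measurable]: "f \<in> borel_measurable N" "g \<in> borel_measurable N" for f g and N :: "'z measure"
    using measurable_compose[OF _ k_meas, of "\<lambda>w. (f w, g w)" N] by simp
  have [measurable]: "B \<in> sets borel" "\<And>m. cball (0 :: real^2) (real m) \<in> sets borel" using B by auto
  have [measurable]: "(\<lambda>\<omega>. index_prod (- {i}) (\<lambda>j. k (X i \<omega>) (X j \<omega>))) \<in> borel_measurable M" for i
    by (intro borel_measurable_index_prod km measurable_point)
  let ?B = "\<lambda>m. B \<inter> cball 0 (real m)"
  have mono: "indicator (?B m) x \<le> (indicator (?B n) x :: ennreal)" if "m \<le> n" for m n x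
    using that by (auto simp: indicator_def)
  have SUP: "(SUP m. indicator (?B m) x) = (indicator B x :: ennreal)" for x
  proof (rule antisym)
    obtain N :: nat where "norm x \<le> real N" using real_arch_simple by blast
    then have "indicator B x = (indicator (?B N) x :: ennreal)" by (auto simp: indicator_def)
    then show "indicator B x \<le> (SUP m. indicator (?B m) x :: ennreal)" by (auto intro: SUP_upper2)
  qed (auto intro!: SUP_least simp: indicator_def)
  have SUP_mult: "(SUP m. indicator (?B m) x * c) = indicator B x * c" for x and c :: ennreal
    by (simp add: SUP_mult_right_ennreal[symmetric] SUP)
  let ?p = "\<lambda>\<omega> i. ennreal (index_prod (- {i}) (\<lambda>j. k (X i \<omega>) (X j \<omega>)))"
  have "(\<integral>\<^sup>+\<omega>. (\<Sum>i. indicator B (X i \<omega>) * ?p \<omega> i) \<partial>M) =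
      (\<integral>\<^sup>+\<omega>. (SUP m. \<Sum>i. indicator (?B m) (X i \<omega>) * ?p \<omega> i) \<partial>M)"
    by (subst ennreal_suminf_SUP_eq[symmetric])
      (auto simp: SUP_mult incseq_def intro!: mult_right_mono mono)
  also have "\<dots> = (SUP m. \<integral>\<^sup>+\<omega>. (\<Sum>i. indicator (?B m) (X i \<omega>) * ?p \<omega> i) \<partial>M)"
  proof (rule nn_integral_monotone_convergence_SUP)
    show "incseq (\<lambda>m \<omega>. \<Sum>i. indicator (?B m) (X i \<omega>) * ?p \<omega> i)"
      by (auto simp: incseq_def le_fun_def intro!: suminf_le mult_right_mono mono)
  qed measurable
  also have "\<dots> = (SUP m. \<integral>\<^sup>+x. indicator (?B m) x * ennreal (lam * exp (- (lam * (LINT y|lborel. 1 - k x y)))) \<partial>lborel)"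
    by (intro SUP_cong refl mecke_bounded[OF cont k int]) (auto simp: bounded_Int)
  also have "\<dots> = (\<integral>\<^sup>+x. (SUP m. indicator (?B m) x * ennreal (lam * exp (- (lam * (LINT y|lborel. 1 - k x y))))) \<partial>lborel)"
    by (rule nn_integral_monotone_convergence_SUP[symmetric])
      (auto simp: incseq_def le_fun_def intro!: mult_right_mono mono)
  finally show ?thesis by (simp add: SUP_mult)
qed

end

section \<open>Independent sources of randomness\<close>

text \<open>Pairing \<open>U\<close> with the identity map into a sub-\<open>\<sigma>\<close>-algebra independent of \<open>U\<close> gives a product
  law; this lets one integrate out \<open>U\<close> while everything measurable in the sub-\<open>\<sigma>\<close>-algebra is kept
  fixed.\<close>

lemma (in prob_space) nn_integral_freezing:
  assumes sub: "subalgebra M A" and U [measurable]: "U \<in> measurable M N"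
    and indep: "\<And>a b. a \<in> sets A \<Longrightarrow> b \<in> sets N \<Longrightarrow>
      prob (a \<inter> (U -` b \<inter> space M)) = prob a * prob (U -` b \<inter> space M)"
    and F: "(\<lambda>(\<omega>, u). F \<omega> u) \<in> borel_measurable (A \<Otimes>\<^sub>M N)"
  shows "(\<integral>\<^sup>+\<omega>. F \<omega> (U \<omega>) \<partial>M) = (\<integral>\<^sup>+\<omega>. (\<integral>\<^sup>+u. F \<omega> u \<partial>distr M N U) \<partial>M)"
proof -
  let ?MA = "restr_to_subalg M A" and ?D = "distr M N U"
  note [measurable_cong] = sets_restr_to_subalg[OF sub]
  have [measurable]: "(\<lambda>\<omega>. \<omega>) \<in> measurable M A"
    using sub by (auto simp: subalgebra_def measurable_def)
  have "space M \<in> sets A"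
    using sub sets.top[of A] by (simp add: subalgebra_def)
  then interpret MA: prob_space ?MA
    by (intro prob_spaceI)
      (simp add: space_restr_to_subalg emeasure_restr_to_subalg[OF sub] emeasure_space_1)
  interpret D: prob_space ?D by (rule prob_space_distr[OF U])
  \<comment> \<open>Here \<open>\<omega>\<close> is seen only through the \<sigma>-algebra
    \<open>A\<close>. Product measures are determined on rectangles, and on
    \<open>a \<times> b\<close> the claim is the assumed product rule.\<close>
  have law: "?MA \<Otimes>\<^sub>M ?D = distr M (A \<Otimes>\<^sub>M N) (\<lambda>\<omega>. (\<omega>, U \<omega>))"
  proof (rule pair_measure_eqI)
    show "sets (?MA \<Otimes>\<^sub>M ?D) = sets (distr M (A \<Otimes>\<^sub>M N) (\<lambda>\<omega>. (\<omega>, U \<omega>)))"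
      by (simp add: sets_restr_to_subalg[OF sub] cong: sets_pair_measure_cong)
    fix a b assume "a \<in> sets ?MA" "b \<in> sets ?D"
    then have a: "a \<in> sets A" "a \<in> sets M" and b: "b \<in> sets N"
      using sub by (auto simp: sets_restr_to_subalg[OF sub] subalgebra_def)
    have "emeasure (distr M (A \<Otimes>\<^sub>M N) (\<lambda>\<omega>. (\<omega>, U \<omega>))) (a \<times> b) = emeasure M (a \<inter> (U -` b \<inter> space M))"
      using a b sets.sets_into_space[OF a(2)] by (subst emeasure_distr) (auto intro!: arg_cong[where f="emeasure M"])
    also have "\<dots> = emeasure M a * emeasure M (U -` b \<inter> space M)"
      using indep[OF a(1) b] by (simp add: emeasure_eq_measure ennreal_mult)
    finally show "emeasure ?MA a * emeasure ?D b = emeasure (distr M (A \<Otimes>\<^sub>M N) (\<lambda>\<omega>. (\<omega>, U \<omega>))) (a \<times> b)"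
      using a b by (simp add: emeasure_restr_to_subalg[OF sub] emeasure_distr)
  qed unfold_locales
  have F': "(\<lambda>(\<omega>, u). F \<omega> u) \<in> borel_measurable (?MA \<Otimes>\<^sub>M ?D)"
    using F by simp
  have F2: "(\<lambda>\<omega>. \<integral>\<^sup>+u. F \<omega> u \<partial>?D) \<in> borel_measurable A"
    by (rule D.borel_measurable_nn_integral) (use F in simp)
  have "(\<integral>\<^sup>+\<omega>. F \<omega> (U \<omega>) \<partial>M) = (\<integral>\<^sup>+p. (case p of (\<omega>, u) \<Rightarrow> F \<omega> u) \<partial>(?MA \<Otimes>\<^sub>M ?D))"
    unfolding law by (subst nn_integral_distr) (use F in auto)
  also have "\<dots> = (\<integral>\<^sup>+\<omega>. (\<integral>\<^sup>+u. F \<omega> u \<partial>?D) \<partial>?MA)"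
    using D.nn_integral_fst[OF F'] by simp
  also have "\<dots> = (\<integral>\<^sup>+\<omega>. (\<integral>\<^sup>+u. F \<omega> u \<partial>?D) \<partial>M)"
    by (rule nn_integral_subalgebra2[OF sub F2])
  finally show ?thesis .
qed

section \<open>The \<sigma>-algebras generated by families of sources\<close>

locale independent_sources = prob_space +
  fixes E :: "'s \<Rightarrow> 'a set set"
  assumes indep: "indep_sets E UNIV" and Int_stable: "\<And>s. Int_stable (E s)"
begin

text \<open>The information carried by the sources in \<open>K\<close>. Disjoint index sets give
  independent \<sigma>-algebras, so measurability with respect to \<open>Sig K\<close> records which
  sources a quantity may depend on, and independence reduces to disjointness of index sets.\<close>

definition Sig :: "'s set \<Rightarrow> 'a measure" where
  "Sig K = sigma (space M) (\<Union>s\<in>K. E s)"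

lemma events: "E s \<subseteq> sets M"
  using indep by (auto simp: indep_sets_def)

lemma space_Sig [simp]: "space (Sig K) = space M"
  by (simp add: Sig_def space_measure_of_conv)

lemma sets_Sig: "sets (Sig K) = sigma_sets (space M) (\<Union>s\<in>K. E s)"
  unfolding Sig_def by (rule sets_measure_of) (use events sets.sets_into_space in blast)

lemma subalgebra_Sig: "subalgebra M (Sig K)"
  unfolding subalgebra_def sets_Sig space_Sig using events by (auto intro!: sets.sigma_sets_subset)

lemma sets_Sig_mono: "K \<subseteq> L \<Longrightarrow> sets (Sig K) \<subseteq> sets (Sig L)"
  unfolding sets_Sig by (intro sigma_sets_mono') auto

lemma measurable_Sig_mono:
  assumes "f \<in> measurable (Sig K) N" "K \<subseteq> L"
  shows "f \<in> measurable (Sig L) N"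
  using assms sets_Sig_mono[of K L] by (auto simp: measurable_def)

lemma measurable_Sig:
  assumes "f \<in> measurable (Sig K) N"
  shows "f \<in> measurable M N"
  by (rule measurable_from_subalg[OF subalgebra_Sig assms])

lemma measurable_Sig_pair_mono:
  assumes "f \<in> measurable (Sig K \<Otimes>\<^sub>M N) N'" "K \<subseteq> L"
  shows "f \<in> measurable (Sig L \<Otimes>\<^sub>M N) N'"
proof -
  have "(\<lambda>\<omega>. \<omega>) \<in> measurable (Sig L) (Sig K)"
    by (rule measurable_Sig_mono[OF _ assms(2)]) simp
  then have "(\<lambda>p. (fst p, snd p)) \<in> measurable (Sig L \<Otimes>\<^sub>M N) (Sig K \<Otimes>\<^sub>M N)"
    by (intro measurable_Pair measurable_compose[OF measurable_fst]) auto
  from measurable_compose[OF this assms(1)] show ?thesis by simp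
qed

lemma prob_Sig_Int:
  assumes "K \<inter> L = {}" "a \<in> sets (Sig K)" "b \<in> sets (Sig L)"
  shows "prob (a \<inter> b) = prob a * prob b"
proof -
  have "indep_sets (\<lambda>b. sigma_sets (space M) (\<Union>s\<in>case_bool K L b. E s)) UNIV"
  proof (rule indep_sets_collect_sigma)
    show "indep_sets E (\<Union>b\<in>UNIV. case_bool K L b)"
      by (rule indep_sets_mono_index[OF _ indep]) simp
    show "disjoint_family (case_bool K L)"
      using assms(1) by (auto simp: disjoint_family_on_def split: bool.splits)
  qed (rule Int_stable)
  then have "indep_set (sigma_sets (space M) (\<Union>s\<in>K. E s)) (sigma_sets (space M) (\<Union>s\<in>L. E s))"
    unfolding indep_set_def by (rule indep_sets_cong[THEN iffD1, rotated -1]) (auto split: bool.splits)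
  then show ?thesis
    using assms(2,3) by (auto dest: indep_setD simp: sets_Sig)
qed

lemma nn_integral_freeze_source:
  assumes U: "U \<in> measurable (Sig {s}) N"
    and F: "(\<lambda>(\<omega>, u). F \<omega> u) \<in> borel_measurable (Sig (- {s}) \<Otimes>\<^sub>M N)"
  shows "(\<integral>\<^sup>+\<omega>. F \<omega> (U \<omega>) \<partial>M) = (\<integral>\<^sup>+\<omega>. (\<integral>\<^sup>+u. F \<omega> u \<partial>distr M N U) \<partial>M)"
proof (rule nn_integral_freezing[OF subalgebra_Sig measurable_Sig[OF U] _ F])
  fix a b assume "a \<in> sets (Sig (- {s}))" "b \<in> sets N"
  then show "prob (a \<inter> (U -` b \<inter> space M)) = prob a * prob (U -` b \<inter> space M)"
    using measurable_sets[OF U, of b] by (intro prob_Sig_Int[of "- {s}" "{s}"]) auto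
qed

text \<open>The factors share the information in \<open>K\<close> but each has a private source
  \<open>r j\<close>, so they can be averaged one at a time. Generality in \<open>H\<close> drives
  the induction: it carries the factor whose turn has not come.\<close>

lemma nn_integral_freeze_sources:
  fixes r :: "'i \<Rightarrow> 's" and f :: "'i \<Rightarrow> 'a \<Rightarrow> 'b \<Rightarrow> ennreal"
  assumes "finite J" "inj_on r J" and U: "\<And>j. j \<in> J \<Longrightarrow> U j \<in> measurable (Sig {r j}) N"
    and f: "\<And>j. j \<in> J \<Longrightarrow> (\<lambda>(\<omega>, u). f j \<omega> u) \<in> borel_measurable (Sig K \<Otimes>\<^sub>M N)"
    and K: "K \<inter> r ` J = {}" and H: "H \<in> borel_measurable (Sig (- r ` J))"
  shows "(\<integral>\<^sup>+\<omega>. H \<omega> * (\<Prod>j\<in>J. f j \<omega> (U j \<omega>)) \<partial>M) =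
    (\<integral>\<^sup>+\<omega>. H \<omega> * (\<Prod>j\<in>J. \<integral>\<^sup>+u. f j \<omega> u \<partial>distr M N (U j)) \<partial>M)"
  using assms
proof (induction J arbitrary: H)
  case (insert j J)
  have U: "U i \<in> measurable (Sig {r i}) N" if "i \<in> insert j J" for i using insert.prems that by blast
  have f: "(\<lambda>(\<omega>, u). f i \<omega> u) \<in> borel_measurable (Sig K \<Otimes>\<^sub>M N)" if "i \<in> insert j J" for i
    using insert.prems that by blast
  have rj: "r j \<notin> r ` J" using insert.prems(1) insert.hyps(2) by auto
  let ?G = "\<lambda>i \<omega>. \<integral>\<^sup>+u. f i \<omega> u \<partial>distr M N (U i)"
  have G: "?G i \<in> borel_measurable (Sig K)" if "i \<in> insert j J" for i
  proof -
    interpret D: prob_space "distr M N (U i)"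
      by (rule prob_space_distr[OF measurable_Sig[OF U[OF that]]])
    show ?thesis by (rule D.borel_measurable_nn_integral) (use f[OF that] in simp)
  qed
  have "(\<lambda>\<omega>. (\<omega>, U j \<omega>)) \<in> measurable (Sig (- r ` J)) (Sig K \<Otimes>\<^sub>M N)"
  proof (rule measurable_Pair)
    show "(\<lambda>\<omega>. \<omega>) \<in> measurable (Sig (- r ` J)) (Sig K)"
      by (rule measurable_Sig_mono[of _ K]) (use insert.prems(4) in auto)
    show "U j \<in> measurable (Sig (- r ` J)) N"
      by (rule measurable_Sig_mono[OF U]) (use rj in auto)
  qed
  from measurable_compose[OF this f[of j]]
  have fj: "(\<lambda>\<omega>. f j \<omega> (U j \<omega>)) \<in> borel_measurable (Sig (- r ` J))" by simp
  have Hj: "(\<lambda>\<omega>. H \<omega> * f j \<omega> (U j \<omega>)) \<in> borel_measurable (Sig (- r ` J))"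
    by (intro borel_measurable_times_ennreal fj measurable_Sig_mono[OF insert.prems(5)]) auto
  have "(\<integral>\<^sup>+\<omega>. H \<omega> * (\<Prod>i\<in>insert j J. f i \<omega> (U i \<omega>)) \<partial>M) =
      (\<integral>\<^sup>+\<omega>. (H \<omega> * f j \<omega> (U j \<omega>)) * (\<Prod>i\<in>J. f i \<omega> (U i \<omega>)) \<partial>M)"
    using insert.hyps by (simp add: mult.assoc)
  also have "\<dots> = (\<integral>\<^sup>+\<omega>. (H \<omega> * f j \<omega> (U j \<omega>)) * (\<Prod>i\<in>J. ?G i \<omega>) \<partial>M)"
    by (rule insert.IH[OF _ _ _ _ Hj]) (use insert.prems in auto)
  also have "\<dots> = (\<integral>\<^sup>+\<omega>. (H \<omega> * (\<Prod>i\<in>J. ?G i \<omega>)) * f j \<omega> (U j \<omega>) \<partial>M)"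
    by (simp add: ac_simps)
  \<comment> \<open>The other factors have become functions of the sources in \<open>K\<close>, so
    the source of \<open>j\<close> now enters only through \<open>U j\<close>.\<close>
  also have "\<dots> = (\<integral>\<^sup>+\<omega>. (\<integral>\<^sup>+u. (H \<omega> * (\<Prod>i\<in>J. ?G i \<omega>)) * f j \<omega> u \<partial>distr M N (U j)) \<partial>M)"
  proof (rule nn_integral_freeze_source[OF U])
    have HG: "(\<lambda>\<omega>. H \<omega> * (\<Prod>i\<in>J. ?G i \<omega>)) \<in> borel_measurable (Sig (- {r j}))"
      by (intro borel_measurable_times_ennreal borel_measurable_prod_ennreal measurable_Sig_mono[OF G] measurable_Sig_mono[OF insert.prems(5)])
        (use insert.prems(4) in auto)
    have "(\<lambda>(\<omega>, u). f j \<omega> u) \<in> borel_measurable (Sig (- {r j}) \<Otimes>\<^sub>M N)"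
      by (rule measurable_Sig_pair_mono[OF f]) (use insert.prems(4) in auto)
    then have "(\<lambda>p. (H (fst p) * (\<Prod>i\<in>J. ?G i (fst p))) * f j (fst p) (snd p)) \<in> borel_measurable (Sig (- {r j}) \<Otimes>\<^sub>M N)"
      by (intro borel_measurable_times_ennreal[of "\<lambda>p. H (fst p) * (\<Prod>i\<in>J. ?G i (fst p))"]
          measurable_compose[OF measurable_fst HG]) (simp add: case_prod_beta')
    then show "(\<lambda>(\<omega>, u). H \<omega> * (\<Prod>i\<in>J. ?G i \<omega>) * f j \<omega> u) \<in> borel_measurable (Sig (- {r j}) \<Otimes>\<^sub>M N)"
      by (simp add: case_prod_beta')
  qed simp
  also have "\<dots> = (\<integral>\<^sup>+\<omega>. (H \<omega> * (\<Prod>i\<in>J. ?G i \<omega>)) * ?G j \<omega> \<partial>M)"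
  proof (rule nn_integral_cong)
    fix \<omega> assume "\<omega> \<in> space M"
    then have "f j \<omega> \<in> borel_measurable N"
      using measurable_compose[OF measurable_Pair1'[of \<omega> "Sig K" N] f[of j]] by simp
    then show "(\<integral>\<^sup>+u. (H \<omega> * (\<Prod>i\<in>J. ?G i \<omega>)) * f j \<omega> u \<partial>distr M N (U j)) = (H \<omega> * (\<Prod>i\<in>J. ?G i \<omega>)) * ?G j \<omega>"
      by (intro nn_integral_cmult) simp
  qed
  finally show ?case using insert.hyps by (simp add: ac_simps)
qed simp

end

section \<open>Sensing and back-off\<close>

text \<open>The case \<open>l = 0\<close> matches the junk value \<open>G / 0 = 0\<close>, which never exceeds the threshold.\<close>

definition block_prob :: "real \<Rightarrow> real \<Rightarrow> real \<Rightarrow> real" where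
  "block_prob \<mu> c l = (if l = 0 then 0 else exp (- (\<mu> * c * l)))"

text \<open>The common shape of one factor in both access indicators: \<open>c\<close> is the
  threshold over the transmit power, \<open>t\<close> and \<open>s\<close> are the timers of the
  contender and of the typical node, \<open>g\<close> is the fading and \<open>l\<close> the path
  loss between them.\<close>

definition backoff_factor :: "real \<Rightarrow> real \<Rightarrow> real \<Rightarrow> real \<Rightarrow> real \<Rightarrow> real" where
  "backoff_factor c t s g l = of_bool (t \<ge> s) + of_bool (t < s) * of_bool (g / l \<le> c)"

lemma backoff_factor_zero_one: "backoff_factor c t s g l \<in> {0, 1}"
  by (auto simp: backoff_factor_def)

lemma block_prob_bounds:
  assumes "0 < \<mu>" "0 < c" "0 \<le> l"
  shows "0 \<le> block_prob \<mu> c l" "block_prob \<mu> c l \<le> 1"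
  using assms by (auto simp: block_prob_def)

lemma borel_measurable_block_prob [measurable]: "block_prob \<mu> c \<in> borel_measurable borel"
  unfolding block_prob_def by measurable

context prob_space
begin

lemma prob_exponential_le_block:
  assumes G: "distributed M lborel G (exponential_density \<mu>)" and "0 < \<mu>" "0 < c" "0 \<le> l"
  shows "(\<integral>\<^sup>+u. ennreal (of_bool (u / l \<le> c)) \<partial>distr M borel G) = ennreal (1 - block_prob \<mu> c l)"
proof -
  have [measurable]: "G \<in> borel_measurable M" using distributed_measurable[OF G] by simp
  have "(\<integral>\<^sup>+u. ennreal (of_bool (u / l \<le> c)) \<partial>distr M borel G) = (\<integral>\<^sup>+\<omega>. ennreal (of_bool (G \<omega> / l \<le> c)) \<partial>M)"
    by (subst nn_integral_distr) auto
  also have "\<dots> = (\<integral>\<^sup>+\<omega>. indicator {\<omega>\<in>space M. G \<omega> / l \<le> c} \<omega> \<partial>M)"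
    by (intro nn_integral_cong) (auto simp: indicator_def)
  also have "\<dots> = ennreal (prob {\<omega>\<in>space M. G \<omega> / l \<le> c})"
    by (simp add: emeasure_eq_measure)
  also have "prob {\<omega>\<in>space M. G \<omega> / l \<le> c} = 1 - block_prob \<mu> c l"
  proof (cases "l = 0")
    case True
    then show ?thesis using assms by (simp add: block_prob_def prob_space)
  next
    case False
    then have "prob {\<omega>\<in>space M. G \<omega> / l \<le> c} = \<P>(\<omega> in M. G \<omega> \<le> c * l)"
      using assms by (simp add: divide_le_eq)
    then show ?thesis
      using exponential_distributedD_le[OF G, of "c * l"] assms False
      by (simp add: block_prob_def ac_simps)
  qed
  finally show ?thesis .
qed

lemma nn_integral_backoff_factor_signal:
  assumes G: "distributed M lborel G (exponential_density \<mu>)" and "0 < \<mu>" "0 < c" "0 \<le> l"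
  shows "(\<integral>\<^sup>+u. ennreal (backoff_factor c t s u l) \<partial>distr M borel G) =
    ennreal (of_bool (t \<ge> s) + of_bool (t < s) * (1 - block_prob \<mu> c l))"
proof (cases "t < s")
  case True
  then show ?thesis
    using prob_exponential_le_block[OF assms] by (simp add: backoff_factor_def)
next
  case False
  interpret D: prob_space "distr M borel G"
    using distributed_measurable[OF G] by (intro prob_space_distr) simp
  show ?thesis using False D.emeasure_space_1 by (simp add: backoff_factor_def)
qed

text \<open>The left end point stays general so that the same computation serves the APs with
  \<open>a = 0\<close> and the eNBs with \<open>a = 1\<close>.\<close>

lemma nn_integral_uniform_timer:
  assumes T: "distributed M lborel T (indicator {a..a + 1 :: real})" and f: "f \<in> borel_measurable borel"
  shows "(\<integral>\<^sup>+u. f u \<partial>distr M borel T) = (\<integral>\<^sup>+u. indicator {a..a + 1} u * f u \<partial>lborel)"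
proof -
  have [measurable]: "T \<in> borel_measurable M" using distributed_measurable[OF T] by simp
  have "(\<integral>\<^sup>+u. f u \<partial>distr M borel T) = (\<integral>\<^sup>+\<omega>. f (T \<omega>) \<partial>M)"
    by (subst nn_integral_distr) (use f in auto)
  also have "\<dots> = (\<integral>\<^sup>+u. indicator {a..a + 1} u * f u \<partial>lborel)"
    using distributed_nn_integral[OF T, of f] f by (simp add: ennreal_indicator)
  finally show ?thesis .
qed

lemma nn_integral_backoff_factor_timer:
  assumes T: "distributed M lborel T (indicator {a..a + 1 :: real})" and s: "a \<le> s" "s \<le> a + 1"
    and p: "0 \<le> p" "p \<le> 1"
  shows "(\<integral>\<^sup>+u. ennreal (of_bool (u \<ge> s) + of_bool (u < s) * (1 - p)) \<partial>distr M borel T) =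
    ennreal (1 - (s - a) * p)"
proof -
  have "(\<integral>\<^sup>+u. ennreal (of_bool (u \<ge> s) + of_bool (u < s) * (1 - p)) \<partial>distr M borel T) =
      (\<integral>\<^sup>+u. indicator {a..a + 1} u * ennreal (of_bool (u \<ge> s) + of_bool (u < s) * (1 - p)) \<partial>lborel)"
    by (rule nn_integral_uniform_timer[OF T]) measurable
  also have "\<dots> = (\<integral>\<^sup>+u. indicator {s..a + 1} u + ennreal (1 - p) * indicator {a..<s} u \<partial>lborel)"
    using s by (intro nn_integral_cong) (auto simp: indicator_def)
  also have "\<dots> = ennreal (a + 1 - s) + ennreal (1 - p) * ennreal (s - a)"
    using s by (subst nn_integral_add) (auto simp: nn_integral_cmult_indicator)
  also have "\<dots> = ennreal (1 - (s - a) * p)"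
  proof -
    have "0 \<le> (1 - p) * (s - a)" using s p by (intro mult_nonneg_nonneg) auto
    then have "ennreal (a + 1 - s) + ennreal (1 - p) * ennreal (s - a) = ennreal (a + 1 - s + (1 - p) * (s - a))"
      using s p by (simp flip: ennreal_mult)
    then show ?thesis by (simp add: algebra_simps)
  qed
  finally show ?thesis .
qed

end

section \<open>Averages of finite products of sensing and back-off factors\<close>

context independent_sources
begin

lemma nn_integral_sensing:
  assumes J: "finite J" and gam: "inj_on gam J"
    and G: "\<And>j. j \<in> J \<Longrightarrow> G j \<in> borel_measurable (Sig {gam j})"
      "\<And>j. j \<in> J \<Longrightarrow> distributed M lborel (G j) (exponential_density \<mu>)"
    and L: "\<And>j. j \<in> J \<Longrightarrow> L j \<in> borel_measurable (Sig K)" and K: "K \<inter> gam ` J = {}"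
    and H: "H \<in> borel_measurable (Sig (- gam ` J))"
    and pos: "0 < \<mu>" "0 < c" "\<And>j \<omega>. 0 \<le> L j \<omega>"
  shows "(\<integral>\<^sup>+\<omega>. H \<omega> * (\<Prod>j\<in>J. ennreal (of_bool (G j \<omega> / L j \<omega> \<le> c))) \<partial>M) =
    (\<integral>\<^sup>+\<omega>. H \<omega> * (\<Prod>j\<in>J. ennreal (1 - block_prob \<mu> c (L j \<omega>))) \<partial>M)"
proof -
  have "(\<integral>\<^sup>+\<omega>. H \<omega> * (\<Prod>j\<in>J. ennreal (of_bool (G j \<omega> / L j \<omega> \<le> c))) \<partial>M) =
    (\<integral>\<^sup>+\<omega>. H \<omega> * (\<Prod>j\<in>J. \<integral>\<^sup>+u. ennreal (of_bool (u / L j \<omega> \<le> c)) \<partial>distr M borel (G j)) \<partial>M)"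
  proof (rule nn_integral_freeze_sources[OF J gam G(1) _ K H])
    fix j assume "j \<in> J"
    note [measurable] = L[OF this]
    show "(\<lambda>(\<omega>, u). ennreal (of_bool (u / L j \<omega> \<le> c))) \<in> borel_measurable (Sig K \<Otimes>\<^sub>M borel)"
      by measurable
  qed
  then show ?thesis
    using prob_exponential_le_block[OF G(2) pos(1,2)] pos(3) by (simp cong: prod.cong)
qed

text \<open>The order of averaging is forced. All factors contain the typical node's own timer
  \<open>T i\<close>, so they are independent only conditionally on it: the fadings go first with
  every timer retained, then the contenders' timers with \<open>T i\<close> retained, and
  \<open>T i\<close> last. Its average remains as the integral over \<open>s\<close>.\<close>

lemma nn_integral_backoff:
  assumes J: "finite J" "i \<notin> J" and inj: "inj_on tau (insert i J)" "inj_on gam J"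
    and disj: "tau ` insert i J \<inter> gam ` J = {}" "K \<inter> (tau ` insert i J \<union> gam ` J) = {}"
    and T: "\<And>j. T j \<in> borel_measurable (Sig {tau j})" "\<And>j. distributed M lborel (T j) (indicator {a..a + 1 :: real})"
    and G: "\<And>j. j \<in> J \<Longrightarrow> G j \<in> borel_measurable (Sig {gam j})"
      "\<And>j. j \<in> J \<Longrightarrow> distributed M lborel (G j) (exponential_density \<mu>)"
    and H: "H \<in> borel_measurable (Sig K)" and L: "\<And>j. j \<in> J \<Longrightarrow> L j \<in> borel_measurable (Sig K)"
    and pos: "0 < \<mu>" "0 < c" "\<And>j \<omega>. 0 \<le> L j \<omega>"
  shows "(\<integral>\<^sup>+\<omega>. H \<omega> * (\<Prod>j\<in>J. ennreal (backoff_factor c (T j \<omega>) (T i \<omega>) (G j \<omega>) (L j \<omega>))) \<partial>M) =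
    (\<integral>\<^sup>+\<omega>. H \<omega> * (\<integral>\<^sup>+s. indicator {0..1} s * (\<Prod>j\<in>J. ennreal (1 - s * block_prob \<mu> c (L j \<omega>))) \<partial>lborel) \<partial>M)"
proof -
  define f :: "real \<Rightarrow> real \<Rightarrow> real \<Rightarrow> ennreal"
    where "f t s l = ennreal (of_bool (t \<ge> s) + of_bool (t < s) * (1 - block_prob \<mu> c l))" for t s l
  \<comment> \<open>One contender's factor averaged over its timer, for an arbitrary own timer
    \<open>s\<close>. As a Lebesgue integral it is visibly measurable in \<open>s\<close> and
    \<open>l\<close> and the same for every contender. Its closed form \<open>g_eq\<close> holds on
    \<open>{a..a + 1}\<close>, which carries the law of \<open>T i\<close>.\<close>
  define g :: "real \<Rightarrow> real \<Rightarrow> ennreal" where "g s l = (\<integral>\<^sup>+u. indicator {a..a + 1} u * f u s l \<partial>lborel)" for s l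
  have g_distr: "(\<integral>\<^sup>+u. f u s l \<partial>distr M borel (T j)) = g s l" for j s l
    unfolding g_def by (rule nn_integral_uniform_timer[OF T(2)]) (simp add: f_def)
  have g_eq: "g s l = ennreal (1 - (s - a) * block_prob \<mu> c l)" if "s \<in> {a..a + 1}" "0 \<le> l" for s l
  proof -
    have "(\<integral>\<^sup>+u. f u s l \<partial>distr M borel (T i)) = ennreal (1 - (s - a) * block_prob \<mu> c l)"
      unfolding f_def using that pos(1,2) block_prob_bounds
      by (intro nn_integral_backoff_factor_timer T(2)) auto
    then show ?thesis by (simp add: g_distr)
  qed

  have "(\<integral>\<^sup>+\<omega>. H \<omega> * (\<Prod>j\<in>J. ennreal (backoff_factor c (T j \<omega>) (T i \<omega>) (G j \<omega>) (L j \<omega>))) \<partial>M) =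
    (\<integral>\<^sup>+\<omega>. H \<omega> * (\<Prod>j\<in>J. \<integral>\<^sup>+u. ennreal (backoff_factor c (T j \<omega>) (T i \<omega>) u (L j \<omega>)) \<partial>distr M borel (G j)) \<partial>M)"
  proof (rule nn_integral_freeze_sources[OF J(1) inj(2) G(1), where K = "K \<union> tau ` insert i J"])
    fix j assume j: "j \<in> J"
    have T': "T l \<in> borel_measurable (Sig (K \<union> tau ` insert i J))" if "l \<in> insert i J" for l
      by (rule measurable_Sig_mono[OF T(1)]) (use that in blast)
    have [measurable]: "L j \<in> borel_measurable (Sig (K \<union> tau ` insert i J))"
      by (rule measurable_Sig_mono[OF L[OF j]]) blast
    have [measurable]: "T j \<in> borel_measurable (Sig (K \<union> tau ` insert i J))"
      "T i \<in> borel_measurable (Sig (K \<union> tau ` insert i J))"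
      using T' j by auto
    show "(\<lambda>(\<omega>, u). ennreal (backoff_factor c (T j \<omega>) (T i \<omega>) u (L j \<omega>))) \<in> borel_measurable (Sig (K \<union> tau ` insert i J) \<Otimes>\<^sub>M borel)"
      unfolding backoff_factor_def by measurable
  next
    show "H \<in> borel_measurable (Sig (- gam ` J))"
      by (rule measurable_Sig_mono[OF H]) (use disj in blast)
    show "(K \<union> tau ` insert i J) \<inter> gam ` J = {}"
      using disj unfolding Int_Un_distrib Int_Un_distrib2 Un_empty by blast
  qed
  also have "\<dots> = (\<integral>\<^sup>+\<omega>. H \<omega> * (\<Prod>j\<in>J. f (T j \<omega>) (T i \<omega>) (L j \<omega>)) \<partial>M)"
    using nn_integral_backoff_factor_signal[OF G(2) pos(1,2)] pos(3) by (simp add: f_def cong: prod.cong)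
  also have "\<dots> = (\<integral>\<^sup>+\<omega>. H \<omega> * (\<Prod>j\<in>J. \<integral>\<^sup>+u. f u (T i \<omega>) (L j \<omega>) \<partial>distr M borel (T j)) \<partial>M)"
  proof (rule nn_integral_freeze_sources[where K = "insert (tau i) K" and r = tau and U = T
        and f = "\<lambda>j \<omega> u. f u (T i \<omega>) (L j \<omega>)"])
    fix j assume j: "j \<in> J"
    have [measurable]: "T i \<in> borel_measurable (Sig (insert (tau i) K))"
      by (rule measurable_Sig_mono[OF T(1)]) blast
    have [measurable]: "L j \<in> borel_measurable (Sig (insert (tau i) K))"
      by (rule measurable_Sig_mono[OF L[OF j]]) blast
    show "(\<lambda>(\<omega>, u). f u (T i \<omega>) (L j \<omega>)) \<in> borel_measurable (Sig (insert (tau i) K) \<Otimes>\<^sub>M borel)"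
      unfolding f_def by measurable
    show "T j \<in> borel_measurable (Sig {tau j})" by (rule T(1))
  next
    show "H \<in> borel_measurable (Sig (- tau ` J))"
      by (rule measurable_Sig_mono[OF H]) (use disj in blast)
    show "insert (tau i) K \<inter> tau ` J = {}"
      using disj J(2) inj(1) by (auto simp: inj_on_def)
  qed (use J inj in \<open>auto intro: inj_on_subset\<close>)
  also have "\<dots> = (\<integral>\<^sup>+\<omega>. H \<omega> * (\<Prod>j\<in>J. g (T i \<omega>) (L j \<omega>)) \<partial>M)"
    by (simp add: g_distr)
  also have "\<dots> = (\<integral>\<^sup>+\<omega>. (\<integral>\<^sup>+s. H \<omega> * (\<Prod>j\<in>J. g s (L j \<omega>)) \<partial>distr M borel (T i)) \<partial>M)"
  proof (rule nn_integral_freeze_source[OF T(1)])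
    have K: "K \<subseteq> - {tau i}" using disj by blast
    note [measurable] = measurable_Sig_mono[OF H K] measurable_Sig_mono[OF L K]
    show "(\<lambda>(\<omega>, s). H \<omega> * (\<Prod>j\<in>J. g s (L j \<omega>))) \<in> borel_measurable (Sig (- {tau i}) \<Otimes>\<^sub>M borel)"
      unfolding g_def f_def by measurable
  qed
  also have "\<dots> = (\<integral>\<^sup>+\<omega>. H \<omega> * (\<integral>\<^sup>+s. indicator {0..1} s * (\<Prod>j\<in>J. ennreal (1 - s * block_prob \<mu> c (L j \<omega>))) \<partial>lborel) \<partial>M)"
  proof (rule nn_integral_cong)
    fix \<omega>
    have [measurable]: "(\<lambda>s. g s l) \<in> borel_measurable borel" for l
      unfolding g_def f_def by measurable
    have "(\<integral>\<^sup>+s. H \<omega> * (\<Prod>j\<in>J. g s (L j \<omega>)) \<partial>distr M borel (T i)) =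
        (\<integral>\<^sup>+s. indicator {a..a + 1} s * (H \<omega> * (\<Prod>j\<in>J. g s (L j \<omega>))) \<partial>lborel)"
      by (rule nn_integral_uniform_timer[OF T(2)]) measurable
    also have "\<dots> = (\<integral>\<^sup>+s. H \<omega> * (indicator {a..a + 1} s * (\<Prod>j\<in>J. ennreal (1 - (s - a) * block_prob \<mu> c (L j \<omega>)))) \<partial>lborel)"
      using pos(3) by (intro nn_integral_cong) (auto simp: indicator_def g_eq)
    also have "\<dots> = H \<omega> * (\<integral>\<^sup>+s. indicator {a..a + 1} s * (\<Prod>j\<in>J. ennreal (1 - (s - a) * block_prob \<mu> c (L j \<omega>))) \<partial>lborel)"
      by (rule nn_integral_cmult) measurable
    \<comment> \<open>Translation by \<open>a\<close> normalises the timer to the unit interval,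
      after which APs and eNBs are treated alike.\<close>
    also have "(\<integral>\<^sup>+s. indicator {a..a + 1} s * (\<Prod>j\<in>J. ennreal (1 - (s - a) * block_prob \<mu> c (L j \<omega>))) \<partial>lborel) =
        (\<integral>\<^sup>+s. indicator {0..1} s * (\<Prod>j\<in>J. ennreal (1 - s * block_prob \<mu> c (L j \<omega>))) \<partial>lborel)"
      by (subst nn_integral_real_affine[of _ 1 a]) (auto simp: indicator_def intro!: nn_integral_cong)
    finally show "(\<integral>\<^sup>+s. H \<omega> * (\<Prod>j\<in>J. g s (L j \<omega>)) \<partial>distr M borel (T i)) =
      H \<omega> * (\<integral>\<^sup>+s. indicator {0..1} s * (\<Prod>j\<in>J. ennreal (1 - s * block_prob \<mu> c (L j \<omega>))) \<partial>lborel)" .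
  qed
  finally show ?thesis .
qed

end

section \<open>Integrals of the signal decay\<close>

text \<open>The blocking probability as a function of the displacement, with
  \<open>\<kappa> = \<mu> * c * (4 * pi / lamc)^2\<close>. At displacement 0 it is 1, where
  \<open>block_prob\<close> is 0 by the convention for division by zero; the value 1 makes it
  continuous, as the Laplace and Mecke formulas demand.\<close>

definition signal_decay :: "real \<Rightarrow> real \<Rightarrow> real^2 \<Rightarrow> real" where
  "signal_decay \<kappa> \<alpha> x = exp (- (\<kappa> * norm x powr \<alpha>))"

lemma power_le_fact_exp:
  fixes x :: real
  assumes "0 \<le> x"
  shows "x ^ n \<le> fact n * exp x"
proof -
  have "(\<lambda>n. x ^ n / fact n) sums exp x"
    using exp_converges[of x] by (simp add: field_simps)
  then have "(\<Sum>k\<in>{n}. x ^ k / fact k) \<le> exp x"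
    using assms sum_le_suminf[of "\<lambda>n. x ^ n / fact n" "{n}"] by (auto simp: sums_iff)
  then show ?thesis by (simp add: field_simps)
qed

text \<open>The weight \<open>(1 + r\<^sup>2)\<^sup>2\<close> has one factor
  \<open>1 + r\<^sup>2\<close> for each of the two coordinates of the plane. The exponential beats
  every power of \<open>r\<close>, however small \<open>\<alpha>\<close> is.\<close>

lemma exp_powr_decay:
  fixes \<kappa> \<alpha> :: real
  assumes "0 < \<kappa>" "0 < \<alpha>"
  obtains C where "0 \<le> C" "\<And>r. 0 \<le> r \<Longrightarrow> exp (- (\<kappa> * r powr \<alpha>)) * (1 + r\<^sup>2)\<^sup>2 \<le> C"
proof -
  \<comment> \<open>The choice of \<open>k\<close> ensures
    \<open>r ^ 4 \<le> (r powr \<alpha>) ^ k\<close> for \<open>r > 1\<close>, and one term of the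
    exponential series controls this power. The first summand of \<open>C\<close> covers
    \<open>r \<le> 1\<close>, the second covers \<open>r > 1\<close>.\<close>
  obtain k :: nat where k: "4 / \<alpha> \<le> real k" using real_arch_simple by blast
  define C where "C = 4 + 4 * (fact k / \<kappa> ^ k)"
  have "exp (- (\<kappa> * r powr \<alpha>)) * (1 + r\<^sup>2)\<^sup>2 \<le> C" if r: "0 \<le> r" for r
  proof (cases "r \<le> 1")
    case True
    then have "(1 + r\<^sup>2)\<^sup>2 \<le> 2\<^sup>2" using r by (intro power_mono) (auto simp: power_le_one)
    then have "exp (- (\<kappa> * r powr \<alpha>)) * (1 + r\<^sup>2)\<^sup>2 \<le> 1 * 4"
      using assms by (intro mult_mono) auto
    also have "\<dots> \<le> C" using assms by (simp add: C_def)
    finally show ?thesis .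
  next
    case False
    have "r ^ 4 = r powr 4" using False by simp
    also have "\<dots> \<le> r powr (\<alpha> * real k)"
      using False k assms by (intro powr_mono) (auto simp: field_simps)
    also have "\<dots> = (r powr \<alpha>) ^ k"
      using False by (simp add: powr_powr[symmetric] powr_realpow)
    finally have "\<kappa> ^ k * r ^ 4 \<le> (\<kappa> * r powr \<alpha>) ^ k"
      using assms by (simp add: power_mult_distrib)
    also have "\<dots> \<le> fact k * exp (\<kappa> * r powr \<alpha>)"
      using assms by (intro power_le_fact_exp) auto
    finally have r4: "r ^ 4 \<le> fact k / \<kappa> ^ k * exp (\<kappa> * r powr \<alpha>)"
      using assms by (simp add: field_simps)
    have "1 + r\<^sup>2 \<le> 2 * r\<^sup>2" using False by (simp add: one_le_power)
    then have "(1 + r\<^sup>2)\<^sup>2 \<le> (2 * r\<^sup>2)\<^sup>2" by (intro power_mono) auto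
    also have "\<dots> = 4 * r ^ 4" by (simp add: power_mult_distrib flip: power_mult)
    also have "\<dots> \<le> 4 * (fact k / \<kappa> ^ k * exp (\<kappa> * r powr \<alpha>))" using r4 by simp
    finally have "exp (- (\<kappa> * r powr \<alpha>)) * (1 + r\<^sup>2)\<^sup>2 \<le> 4 * (fact k / \<kappa> ^ k)"
      by (simp add: exp_minus field_simps)
    then show ?thesis by (simp add: C_def)
  qed
  moreover have "0 \<le> C" using assms by (simp add: C_def)
  ultimately show thesis using that by blast
qed

lemma nn_integral_inverse_1_plus_square:
  "(\<integral>\<^sup>+y. ennreal (inverse (1 + (y::real)\<^sup>2)) \<partial>lborel) < \<infinity>"
proof -
  have "integrable lborel (\<lambda>y::real. inverse (1 + y\<^sup>2))"
    using integrable_inverse_1_plus_square by (simp add: set_integrable_def einterval_def)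
  then show ?thesis
    by (simp add: nn_integral_eq_integral)
qed

lemma continuous_on_signal_decay:
  assumes "0 < \<alpha>"
  shows "continuous_on UNIV (signal_decay \<kappa> \<alpha>)"
  unfolding signal_decay_def using assms by (intro continuous_intros continuous_on_powr') auto

lemma borel_measurable_signal_decay [measurable]: "signal_decay \<kappa> \<alpha> \<in> borel_measurable borel"
  unfolding signal_decay_def by measurable

lemma signal_decay_bounds:
  assumes "0 < \<kappa>"
  shows "0 < signal_decay \<kappa> \<alpha> x" "signal_decay \<kappa> \<alpha> x \<le> 1"
  using assms by (auto simp: signal_decay_def)

text \<open>Comparison with a product of one-dimensional Cauchy densities, up to normalisation: each
  \<open>1 + (x \<bullet> b)\<^sup>2\<close> is at most \<open>1 + (norm x)\<^sup>2\<close>, and the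
  integral of the product splits over the coordinates.\<close>

lemma integrable_signal_decay:
  assumes "0 < \<kappa>" "0 < \<alpha>"
  shows "integrable lborel (signal_decay \<kappa> \<alpha>)"
proof -
  obtain C where C: "0 \<le> C" "\<And>r. 0 \<le> r \<Longrightarrow> exp (- (\<kappa> * r powr \<alpha>)) * (1 + r\<^sup>2)\<^sup>2 \<le> C"
    using exp_powr_decay[OF assms] by blast
  have bound: "signal_decay \<kappa> \<alpha> x \<le> C * (\<Prod>b\<in>Basis. inverse (1 + (x \<bullet> b)\<^sup>2))" for x
  proof -
    have "(\<Prod>b\<in>Basis. 1 + (x \<bullet> b)\<^sup>2) \<le> (\<Prod>b\<in>(Basis :: (real^2) set). 1 + (norm x)\<^sup>2)"
      by (intro prod_mono) (auto simp: abs_le_square_iff[symmetric] Basis_le_norm)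
    also have "\<dots> = (1 + (norm x)\<^sup>2)\<^sup>2" by simp
    finally have "signal_decay \<kappa> \<alpha> x * (\<Prod>b\<in>Basis. 1 + (x \<bullet> b)\<^sup>2) \<le> signal_decay \<kappa> \<alpha> x * (1 + (norm x)\<^sup>2)\<^sup>2"
      by (intro mult_left_mono) (auto simp: signal_decay_def)
    also have "\<dots> \<le> C" unfolding signal_decay_def by (rule C(2)) simp
    finally have "signal_decay \<kappa> \<alpha> x * (\<Prod>b\<in>Basis. 1 + (x \<bullet> b)\<^sup>2) \<le> C" .
    moreover have "0 < (\<Prod>b\<in>Basis. 1 + (x \<bullet> b)\<^sup>2)"
      by (intro prod_pos) (auto simp: add_pos_nonneg)
    ultimately show ?thesis
      using prod_inversef[of "\<lambda>b. 1 + (x \<bullet> b)\<^sup>2" Basis] by (simp add: comp_def field_simps)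
  qed
  have "(\<integral>\<^sup>+x. ennreal (signal_decay \<kappa> \<alpha> x) \<partial>lborel) \<le>
      (\<integral>\<^sup>+x. ennreal C * (\<Prod>b\<in>(Basis :: (real^2) set). ennreal (inverse (1 + (x \<bullet> b)\<^sup>2))) \<partial>lborel)"
  proof (rule nn_integral_mono)
    fix x
    have "ennreal (signal_decay \<kappa> \<alpha> x) \<le> ennreal (C * (\<Prod>b\<in>Basis. inverse (1 + (x \<bullet> b)\<^sup>2)))"
      by (rule ennreal_leI[OF bound])
    also have "\<dots> = ennreal C * ennreal (\<Prod>b\<in>Basis. inverse (1 + (x \<bullet> b)\<^sup>2))"
      using C(1) by (intro ennreal_mult prod_nonneg) auto
    also have "ennreal (\<Prod>b\<in>Basis. inverse (1 + (x \<bullet> b)\<^sup>2)) = (\<Prod>b\<in>Basis. ennreal (inverse (1 + (x \<bullet> b)\<^sup>2)))"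
      by (rule prod_ennreal[symmetric]) auto
    finally show "ennreal (signal_decay \<kappa> \<alpha> x) \<le> ennreal C * (\<Prod>b\<in>Basis. ennreal (inverse (1 + (x \<bullet> b)\<^sup>2)))" .
  qed
  also have "\<dots> = ennreal C * (\<Prod>b\<in>(Basis :: (real^2) set). \<integral>\<^sup>+y. ennreal (inverse (1 + y\<^sup>2)) \<partial>lborel)"
    by (subst nn_integral_cmult) (auto simp: nn_integral_lborel_prod[where f="\<lambda>_ y. ennreal (inverse (1 + y\<^sup>2))"])
  also have "\<dots> < \<infinity>"
    using nn_integral_inverse_1_plus_square by (simp add: ennreal_mult_less_top power2_eq_square)
  finally show ?thesis
    by (intro integrableI_nonneg) (auto simp: signal_decay_def)
qed

text \<open>This makes the expected number of blocking contenders nonzero, so that it may stand in a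
  denominator.\<close>

lemma integral_signal_decay_pos:
  assumes "0 < \<kappa>" "0 < \<alpha>"
  shows "0 < (LINT x|lborel. signal_decay \<kappa> \<alpha> x)"
proof -
  have "(LINT x|lborel. signal_decay \<kappa> \<alpha> x) \<noteq> 0"
  proof
    assume "(LINT x|lborel. signal_decay \<kappa> \<alpha> x) = 0"
    then have "AE x in lborel. signal_decay \<kappa> \<alpha> x = 0"
      by (subst (asm) integral_nonneg_eq_0_iff_AE[OF integrable_signal_decay[OF assms]])
        (auto simp: signal_decay_def)
    then have "AE x in (lborel :: (real^2) measure). False"
      by (simp add: signal_decay_def)
    then show False by (simp add: eventually_False ae_filter_eq_bot_iff)
  qed
  moreover have "0 \<le> (LINT x|lborel. signal_decay \<kappa> \<alpha> x)"
    by (rule Bochner_Integration.integral_nonneg) (simp add: signal_decay_def)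
  ultimately show ?thesis by linarith
qed

text \<open>Stationarity enters here: by translation invariance of Lebesgue measure the exponent is
  the same for every position of the typical node.\<close>

lemma integral_signal_decay_translate:
  "(LINT y|lborel. signal_decay \<kappa> \<alpha> (y - x)) = (LINT y|lborel. signal_decay \<kappa> \<alpha> y)"
proof -
  have "(LINT y|lborel. signal_decay \<kappa> \<alpha> (y - x)) = (LINT y|distr lborel borel ((+) x). signal_decay \<kappa> \<alpha> (y - x))"
    by (simp add: lborel_distr_plus)
  also have "\<dots> = (LINT y|lborel. signal_decay \<kappa> \<alpha> y)"
    by (subst integral_distr) auto
  finally show ?thesis .
qed

lemma integrable_signal_decay_translate:
  assumes "0 < \<kappa>" "0 < \<alpha>"
  shows "integrable lborel (\<lambda>y. signal_decay \<kappa> \<alpha> (y - x))"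
proof -
  have "integrable (distr lborel borel ((+) x)) (\<lambda>y. signal_decay \<kappa> \<alpha> (y - x))"
    by (subst integrable_distr_eq) (auto simp: integrable_signal_decay[OF assms])
  then show ?thesis by (simp add: lborel_distr_plus)
qed

lemma nn_integral_exp_unit_interval:
  fixes N :: real
  assumes "0 < N"
  shows "(\<integral>\<^sup>+s. indicator {0..1} s * ennreal (exp (- (s * N))) \<partial>lborel) = ennreal ((1 - exp (- N)) / N)"
proof -
  have "(\<integral>\<^sup>+s. ennreal (exp (- (s * N))) * indicator {0..1} s \<partial>lborel) =
      ennreal (- exp (- (1 * N)) / N - - exp (- (0 * N)) / N)"
    using assms by (intro nn_integral_FTC_Icc) (auto intro!: derivative_eq_intros)
  then show ?thesis by (simp add: mult.commute diff_divide_distrib)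
qed

section \<open>The medium access probabilities\<close>

context independent_sources
begin

text \<open>Freezing handles finitely many factors, so the identity is used for the products over
  \<open>I \<inter> {..<n}\<close>. Both sides converge by domination, since \<open>H\<close> and
  all partial products are at most 1.\<close>

lemma nn_integral_sensing_limit:
  fixes gam :: "nat \<Rightarrow> 's"
  assumes gam: "inj gam"
    and G: "\<And>j. G j \<in> borel_measurable (Sig {gam j})"
      "\<And>j. distributed M lborel (G j) (exponential_density \<mu>)"
    and L: "\<And>j. L j \<in> borel_measurable (Sig K)" and K: "K \<inter> range gam = {}"
    and H: "H \<in> borel_measurable (Sig K)" "\<And>\<omega>. H \<omega> \<le> 1"
    and pos: "0 < \<mu>" "0 < c" "\<And>j \<omega>. 0 \<le> L j \<omega>"
  shows "(\<integral>\<^sup>+\<omega>. H \<omega> * ennreal (index_prod I (\<lambda>j. of_bool (G j \<omega> / L j \<omega> \<le> c))) \<partial>M) =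
    (\<integral>\<^sup>+\<omega>. H \<omega> * ennreal (index_prod I (\<lambda>j. 1 - block_prob \<mu> c (L j \<omega>))) \<partial>M)"
proof (rule LIMSEQ_unique)
  note [measurable] = measurable_Sig[OF H(1)] measurable_Sig[OF G(1)] measurable_Sig[OF L]
  have H1: "H \<omega> * ennreal x \<le> 1" if "0 \<le> x" "x \<le> 1" for \<omega> x
    using mult_mono[OF H(2)[of \<omega>], of "ennreal x" 1] that by simp
  have H_lim: "(\<lambda>n. H \<omega> * ennreal (x n)) \<longlonglongrightarrow> H \<omega> * ennreal y" if "x \<longlonglongrightarrow> y" for \<omega> x y
    using that H(2)[of \<omega>] by (intro ennreal_tendsto_cmult tendsto_ennrealI) (auto simp: less_top[symmetric] top_unique)
  let ?J = "\<lambda>n. I \<inter> {..<n}"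
  have block: "0 \<le> 1 - block_prob \<mu> c (L j \<omega>)" "1 - block_prob \<mu> c (L j \<omega>) \<le> 1" for j \<omega>
    using block_prob_bounds[OF pos(1,2) pos(3)[of j \<omega>]] by auto
  show "(\<lambda>n. \<integral>\<^sup>+\<omega>. H \<omega> * ennreal (\<Prod>j\<in>?J n. 1 - block_prob \<mu> c (L j \<omega>)) \<partial>M) \<longlonglongrightarrow>
      (\<integral>\<^sup>+\<omega>. H \<omega> * ennreal (index_prod I (\<lambda>j. 1 - block_prob \<mu> c (L j \<omega>))) \<partial>M)"
    using block by (intro nn_integral_dominated_convergence[where w = "\<lambda>_. 1"])
      (auto simp: emeasure_space_1 intro!: H1 H_lim prod_le_1 prod_nonneg index_prod_LIMSEQ)
  have "(\<integral>\<^sup>+\<omega>. H \<omega> * ennreal (\<Prod>j\<in>?J n. 1 - block_prob \<mu> c (L j \<omega>)) \<partial>M) =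
      (\<integral>\<^sup>+\<omega>. H \<omega> * ennreal (\<Prod>j\<in>?J n. of_bool (G j \<omega> / L j \<omega> \<le> c)) \<partial>M)" for n
  proof -
    have "H \<in> borel_measurable (Sig (- gam ` ?J n))"
      by (rule measurable_Sig_mono[OF H(1)]) (use K in blast)
    then have "(\<integral>\<^sup>+\<omega>. H \<omega> * (\<Prod>j\<in>?J n. ennreal (of_bool (G j \<omega> / L j \<omega> \<le> c))) \<partial>M) =
        (\<integral>\<^sup>+\<omega>. H \<omega> * (\<Prod>j\<in>?J n. ennreal (1 - block_prob \<mu> c (L j \<omega>))) \<partial>M)"
      by (intro nn_integral_sensing[where gam = gam and K = K])
        (use K in \<open>auto intro: inj_on_subset[OF gam] G L pos\<close>)
    then show ?thesis using block by (simp add: prod_ennreal)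
  qed
  moreover have "(\<lambda>n. \<integral>\<^sup>+\<omega>. H \<omega> * ennreal (\<Prod>j\<in>?J n. of_bool (G j \<omega> / L j \<omega> \<le> c)) \<partial>M) \<longlonglongrightarrow>
      (\<integral>\<^sup>+\<omega>. H \<omega> * ennreal (index_prod I (\<lambda>j. of_bool (G j \<omega> / L j \<omega> \<le> c))) \<partial>M)"
    by (intro nn_integral_dominated_convergence[where w = "\<lambda>_. 1"])
      (auto simp: emeasure_space_1 intro!: H1 H_lim prod_le_1 prod_nonneg index_prod_LIMSEQ)
  ultimately show "(\<lambda>n. \<integral>\<^sup>+\<omega>. H \<omega> * ennreal (\<Prod>j\<in>?J n. 1 - block_prob \<mu> c (L j \<omega>)) \<partial>M) \<longlonglongrightarrow>
      (\<integral>\<^sup>+\<omega>. H \<omega> * ennreal (index_prod I (\<lambda>j. of_bool (G j \<omega> / L j \<omega> \<le> c))) \<partial>M)"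
    by simp
qed

text \<open>The same truncation as for sensing, but the right-hand side has two nested limits: for
  fixed \<open>\<omega>\<close> in the integral over \<open>s\<close>, dominated on the unit
  interval, and then in the integral over \<open>\<omega>\<close>, dominated by 1.\<close>

lemma nn_integral_backoff_limit:
  fixes tau gam :: "nat \<Rightarrow> 's"
  assumes inj: "inj tau" "inj gam"
    and disj: "range tau \<inter> range gam = {}" "K \<inter> (range tau \<union> range gam) = {}"
    and T: "\<And>j. T j \<in> borel_measurable (Sig {tau j})" "\<And>j. distributed M lborel (T j) (indicator {a..a + 1 :: real})"
    and G: "\<And>j. G j \<in> borel_measurable (Sig {gam j})"
      "\<And>j. distributed M lborel (G j) (exponential_density \<mu>)"
    and L: "\<And>j. L j \<in> borel_measurable (Sig K)"
    and H: "H \<in> borel_measurable (Sig K)" "\<And>\<omega>. H \<omega> \<le> 1"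
    and pos: "0 < \<mu>" "0 < c" "\<And>j \<omega>. 0 \<le> L j \<omega>"
  shows "(\<integral>\<^sup>+\<omega>. H \<omega> * ennreal (index_prod (- {i}) (\<lambda>j. backoff_factor c (T j \<omega>) (T i \<omega>) (G j \<omega>) (L j \<omega>))) \<partial>M) =
    (\<integral>\<^sup>+\<omega>. H \<omega> * (\<integral>\<^sup>+s. indicator {0..1} s * ennreal (index_prod (- {i}) (\<lambda>j. 1 - s * block_prob \<mu> c (L j \<omega>))) \<partial>lborel) \<partial>M)"
proof (rule LIMSEQ_unique)
  note [measurable] = measurable_Sig[OF H(1)] measurable_Sig[OF G(1)] measurable_Sig[OF L] measurable_Sig[OF T(1)]
  have H1: "H \<omega> * x \<le> 1" if "x \<le> 1" for \<omega> x
    using mult_mono[OF H(2)[of \<omega>], of x 1] that by simp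
  have H_lim: "(\<lambda>n. H \<omega> * x n) \<longlonglongrightarrow> H \<omega> * y" if "x \<longlonglongrightarrow> y" for \<omega> x y
    using that H(2)[of \<omega>] by (intro ennreal_tendsto_cmult) (auto simp: less_top[symmetric] top_unique)
  let ?J = "\<lambda>n. - {i} \<inter> {..<n}"
  let ?f = "\<lambda>j \<omega>. backoff_factor c (T j \<omega>) (T i \<omega>) (G j \<omega>) (L j \<omega>)"
  let ?g = "\<lambda>s j \<omega>. 1 - s * block_prob \<mu> c (L j \<omega>)"
  let ?I = "\<lambda>n \<omega>. \<integral>\<^sup>+s. indicator {0..1} s * ennreal (\<Prod>j\<in>?J n. ?g s j \<omega>) \<partial>lborel"
  have f: "0 \<le> ?f j \<omega>" "?f j \<omega> \<le> 1" for j \<omega>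
    using backoff_factor_zero_one[of c "T j \<omega>" "T i \<omega>" "G j \<omega>" "L j \<omega>"] by auto
  have [measurable]: "?f j \<in> borel_measurable M" for j
    unfolding backoff_factor_def by measurable
  have g: "0 \<le> ?g s j \<omega>" "?g s j \<omega> \<le> 1" if "s \<in> {0..1}" for s j \<omega>
    using block_prob_bounds[OF pos(1,2) pos(3)[of j \<omega>]] that
      mult_mono[of s 1 "block_prob \<mu> c (L j \<omega>)" 1] by auto
  have unit: "(\<integral>\<^sup>+s. indicator {0..1 :: real} s \<partial>lborel) = 1"
    by simp
  have I1: "?I n \<omega> \<le> 1" for n \<omega>
    using g unfolding unit[symmetric]
    by (intro nn_integral_mono) (auto simp: indicator_def intro!: prod_le_1)
  show "(\<lambda>n. \<integral>\<^sup>+\<omega>. H \<omega> * ?I n \<omega> \<partial>M) \<longlonglongrightarrow>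
      (\<integral>\<^sup>+\<omega>. H \<omega> * (\<integral>\<^sup>+s. indicator {0..1} s * ennreal (index_prod (- {i}) (\<lambda>j. ?g s j \<omega>)) \<partial>lborel) \<partial>M)"
  proof (rule nn_integral_dominated_convergence[where w = "\<lambda>_. 1"])
    show "AE \<omega> in M. H \<omega> * ?I n \<omega> \<le> 1" for n
      by (intro AE_I2 H1 I1)
    have "(\<lambda>n. ?I n \<omega>) \<longlonglongrightarrow> (\<integral>\<^sup>+s. indicator {0..1} s * ennreal (index_prod (- {i}) (\<lambda>j. ?g s j \<omega>)) \<partial>lborel)" for \<omega>
    proof (rule nn_integral_dominated_convergence[where w = "indicator {0..1}"])
      show "AE s in lborel. indicator {0..1} s * ennreal (\<Prod>j\<in>?J n. ?g s j \<omega>) \<le> indicator {0..1} s" for n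
        using g by (intro AE_I2) (auto simp: indicator_def intro!: prod_le_1)
      show "AE s in lborel. (\<lambda>n. indicator {0..1} s * ennreal (\<Prod>j\<in>?J n. ?g s j \<omega>)) \<longlonglongrightarrow>
          indicator {0..1} s * ennreal (index_prod (- {i}) (\<lambda>j. ?g s j \<omega>))"
      proof (rule AE_I2)
        fix s :: real
        show "(\<lambda>n. indicator {0..1} s * ennreal (\<Prod>j\<in>?J n. ?g s j \<omega>)) \<longlonglongrightarrow>
          indicator {0..1} s * ennreal (index_prod (- {i}) (\<lambda>j. ?g s j \<omega>))"
          by (cases "s \<in> {0..1}") (auto intro!: tendsto_ennrealI index_prod_LIMSEQ g)
      qed
    qed auto
    then show "AE \<omega> in M. (\<lambda>n. H \<omega> * ?I n \<omega>) \<longlonglongrightarrow>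
        H \<omega> * (\<integral>\<^sup>+s. indicator {0..1} s * ennreal (index_prod (- {i}) (\<lambda>j. ?g s j \<omega>)) \<partial>lborel)"
      by (intro AE_I2 H_lim)
  qed (auto simp: emeasure_space_1)
  have "(\<integral>\<^sup>+\<omega>. H \<omega> * ?I n \<omega> \<partial>M) = (\<integral>\<^sup>+\<omega>. H \<omega> * ennreal (\<Prod>j\<in>?J n. ?f j \<omega>) \<partial>M)" for n
  proof -
    have eq: "indicator {0..1} s * ennreal (\<Prod>j\<in>?J n. ?g s j \<omega>) = indicator {0..1} s * (\<Prod>j\<in>?J n. ennreal (?g s j \<omega>))" for s \<omega>
      using g by (auto simp: indicator_def prod_ennreal)
    have "(\<integral>\<^sup>+\<omega>. H \<omega> * (\<Prod>j\<in>?J n. ennreal (?f j \<omega>)) \<partial>M) = (\<integral>\<^sup>+\<omega>. H \<omega> * ?I n \<omega> \<partial>M)"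
      unfolding eq
    proof (rule nn_integral_backoff[where tau = tau and gam = gam and K = K and a = a])
      show "inj_on tau (insert i (?J n))" "inj_on gam (?J n)"
        by (rule inj_on_subset[OF inj(1) subset_UNIV] inj_on_subset[OF inj(2) subset_UNIV])+
      show "tau ` insert i (?J n) \<inter> gam ` ?J n = {}"
        using disj(1) by blast
      have "tau ` insert i (?J n) \<union> gam ` ?J n \<subseteq> range tau \<union> range gam" by blast
      then show "K \<inter> (tau ` insert i (?J n) \<union> gam ` ?J n) = {}"
        using disj(2) by blast
    qed (use T G H L pos in auto)
    then show ?thesis using f by (simp add: prod_ennreal)
  qed
  moreover have "(\<lambda>n. \<integral>\<^sup>+\<omega>. H \<omega> * ennreal (\<Prod>j\<in>?J n. ?f j \<omega>) \<partial>M) \<longlonglongrightarrow>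
      (\<integral>\<^sup>+\<omega>. H \<omega> * ennreal (index_prod (- {i}) (\<lambda>j. ?f j \<omega>)) \<partial>M)"
  proof (rule nn_integral_dominated_convergence[where w = "\<lambda>_. 1"])
    have "(\<Prod>j\<in>?J n. ?f j \<omega>) \<le> 1" for n \<omega>
      using f by (intro prod_le_1) auto
    then show "AE \<omega> in M. H \<omega> * ennreal (\<Prod>j\<in>?J n. ?f j \<omega>) \<le> 1" for n
      by (intro AE_I2 H1) simp
    show "AE \<omega> in M. (\<lambda>n. H \<omega> * ennreal (\<Prod>j\<in>?J n. ?f j \<omega>)) \<longlonglongrightarrow>
        H \<omega> * ennreal (index_prod (- {i}) (\<lambda>j. ?f j \<omega>))"
      using f by (intro AE_I2 H_lim tendsto_ennrealI index_prod_LIMSEQ)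
  qed (auto simp: emeasure_space_1)
  ultimately show "(\<lambda>n. \<integral>\<^sup>+\<omega>. H \<omega> * ?I n \<omega> \<partial>M) \<longlonglongrightarrow>
      (\<integral>\<^sup>+\<omega>. H \<omega> * ennreal (index_prod (- {i}) (\<lambda>j. ?f j \<omega>)) \<partial>M)"
    by simp
qed

end

section \<open>Averages over the point processes and the Palm ratio\<close>

lemma block_prob_path_loss:
  assumes "0 < \<mu>" "0 < c" "0 < lamc" "x \<noteq> y"
  shows "block_prob \<mu> c (path_loss lamc \<alpha> (norm (x - y))) = signal_decay (\<mu> * c * (4 * pi / lamc)\<^sup>2) \<alpha> (x - y)"
  using assms by (simp add: block_prob_def path_loss_def signal_decay_def ac_simps)

lemma path_loss_nonneg: "0 \<le> path_loss lamc \<alpha> d"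
  by (simp add: path_loss_def)

lemma borel_measurable_path_loss [measurable]: "path_loss lamc \<alpha> \<in> borel_measurable borel"
  unfolding path_loss_def by measurable

context planar_poisson
begin

lemma AE_no_point_at: "AE \<omega> in M. \<forall>j. X j \<omega> \<noteq> y"
proof -
  have "(\<integral>\<^sup>+\<omega>. of_nat (point_count X {y} \<omega>) \<partial>M) = 0"
    using nn_integral_point_count[of "{y}"] by simp
  moreover have "(\<lambda>\<omega>. of_nat (point_count X {y} \<omega>) :: ennreal) \<in> borel_measurable M"
    using measurable_point_count[of "{y}"] by measurable
  ultimately have "AE \<omega> in M. (of_nat (point_count X {y} \<omega>) :: ennreal) = 0"
    by (simp add: nn_integral_0_iff_AE)
  \<comment> \<open>A cardinality is 0 also for an infinite set, so count 0 excludes a point at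
    \<open>y\<close> only together with finiteness.\<close>
  moreover have "AE \<omega> in M. finite {i. X i \<omega> \<in> {y}}" by (rule AE_finite) simp
  ultimately show ?thesis
    by eventually_elim (auto simp: point_count_def)
qed

text \<open>The position \<open>y\<close> is deterministic, so almost surely no point sits there and
  the continuous kernel may be used; translation then removes \<open>y\<close> from the
  exponent.\<close>

lemma laplace_sensing:
  assumes pos: "0 < \<mu>" "0 < c" "0 < lamc" "0 < \<alpha>" and \<kappa>: "\<kappa> = \<mu> * c * (4 * pi / lamc)\<^sup>2"
  shows "(\<integral>\<^sup>+\<omega>. ennreal (index_prod UNIV (\<lambda>j. 1 - block_prob \<mu> c (path_loss lamc \<alpha> (norm (X j \<omega> - y))))) \<partial>M) =
    ennreal (exp (- (lam * (LINT x|lborel. signal_decay \<kappa> \<alpha> x))))"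
proof -
  have \<kappa>0: "0 < \<kappa>" using pos \<kappa> by simp
  note decay = signal_decay_bounds[OF \<kappa>0, of \<alpha>]
  have "AE \<omega> in M. index_prod UNIV (\<lambda>j. 1 - block_prob \<mu> c (path_loss lamc \<alpha> (norm (X j \<omega> - y)))) =
      index_prod UNIV (\<lambda>j. 1 - signal_decay \<kappa> \<alpha> (X j \<omega> - y))"
    using AE_no_point_at[of y]
    by eventually_elim (auto simp: block_prob_path_loss pos \<kappa> intro!: index_prod_cong)
  then have "(\<integral>\<^sup>+\<omega>. ennreal (index_prod UNIV (\<lambda>j. 1 - block_prob \<mu> c (path_loss lamc \<alpha> (norm (X j \<omega> - y))))) \<partial>M) =
      (\<integral>\<^sup>+\<omega>. ennreal (index_prod UNIV (\<lambda>j. 1 - signal_decay \<kappa> \<alpha> (X j \<omega> - y))) \<partial>M)"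
    by (intro nn_integral_cong_AE) auto
  also have "\<dots> = ennreal (exp (- (lam * (LINT x|lborel. 1 - (1 - signal_decay \<kappa> \<alpha> (x - y))))))"
  proof (rule laplace)
    show "continuous_on UNIV (\<lambda>x. 1 - signal_decay \<kappa> \<alpha> (x - y))"
      by (intro continuous_intros continuous_on_compose2[OF continuous_on_signal_decay[OF pos(4)]]) auto
  qed (use decay less_imp_le in \<open>auto simp: integrable_signal_decay_translate[OF \<kappa>0 pos(4)]\<close>)
  finally show ?thesis by (simp add: integral_signal_decay_translate)
qed

text \<open>The sum stands outside the expectation because the back-off is averaged for each index
  separately. Mecke's formula needs it inside and a fixed timer value, so the integral over
  \<open>s\<close> is first moved outermost by Tonelli. Each fixed \<open>s\<close> then yields
  \<open>exp (- (s * N))\<close>.\<close>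

lemma mecke_backoff:
  assumes pos: "0 < \<mu>" "0 < c" "0 < lamc" "0 < \<alpha>" and \<kappa>: "\<kappa> = \<mu> * c * (4 * pi / lamc)\<^sup>2"
    and N: "N = lam * (LINT x|lborel. signal_decay \<kappa> \<alpha> x)" and B: "B \<in> sets borel"
  shows "(\<Sum>i. \<integral>\<^sup>+\<omega>. indicator B (X i \<omega>) * (\<integral>\<^sup>+s. indicator {0..1} s *
        ennreal (index_prod (- {i}) (\<lambda>j. 1 - s * block_prob \<mu> c (path_loss lamc \<alpha> (norm (X j \<omega> - X i \<omega>))))) \<partial>lborel) \<partial>M) =
    ennreal lam * emeasure lborel B * ennreal ((1 - exp (- N)) / N)"
proof -
  have \<kappa>0: "0 < \<kappa>" using pos \<kappa> by simp
  have N0: "0 < N" using intensity_pos integral_signal_decay_pos[OF \<kappa>0 pos(4)] N by simp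
  note decay = signal_decay_bounds[OF \<kappa>0, of \<alpha>]
  have [measurable]: "B \<in> sets borel" by fact
  interpret L: pair_sigma_finite lborel M
    by (intro pair_sigma_finite.intro sigma_finite_lborel) unfold_locales
  let ?p = "\<lambda>s i \<omega>. ennreal (index_prod (- {i}) (\<lambda>j. 1 - s * signal_decay \<kappa> \<alpha> (X j \<omega> - X i \<omega>)))"
  have mecke_s: "(\<integral>\<^sup>+\<omega>. (\<Sum>i. indicator B (X i \<omega>) * ?p s i \<omega>) \<partial>M) = ennreal lam * emeasure lborel B * ennreal (exp (- (s * N)))"
    if s: "s \<in> {0..1}" for s
  proof -
    have "(\<integral>\<^sup>+\<omega>. (\<Sum>i. indicator B (X i \<omega>) * ?p s i \<omega>) \<partial>M) =
      (\<integral>\<^sup>+x. indicator B x * ennreal (lam * exp (- (lam * (LINT y|lborel. 1 - (1 - s * signal_decay \<kappa> \<alpha> (y - x)))))) \<partial>lborel)"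
    proof (rule mecke[OF _ _ _ _ B])
      show "continuous_on UNIV (\<lambda>p. 1 - s * signal_decay \<kappa> \<alpha> (snd p - fst p))"
        by (intro continuous_intros continuous_on_compose2[OF continuous_on_signal_decay[OF pos(4)]]) auto
      show "0 \<le> 1 - s * signal_decay \<kappa> \<alpha> (y - x)" "1 - s * signal_decay \<kappa> \<alpha> (y - x) \<le> 1" for x y
        using mult_mono[of s 1 "signal_decay \<kappa> \<alpha> (y - x)" 1] s decay[of "y - x"] by auto
    qed (simp add: integrable_signal_decay_translate[OF \<kappa>0 pos(4)])
    also have "\<dots> = (\<integral>\<^sup>+x. ennreal (lam * exp (- (s * N))) * indicator B x \<partial>lborel)"
      by (simp add: integral_signal_decay_translate N ac_simps)
    also have "\<dots> = ennreal (lam * exp (- (s * N))) * emeasure lborel B"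
      by (rule nn_integral_cmult_indicator) simp
    finally show ?thesis using intensity_pos by (simp add: ennreal_mult ac_simps)
  qed
  have "(\<integral>\<^sup>+\<omega>. indicator B (X i \<omega>) * (\<integral>\<^sup>+s. indicator {0..1} s *
        ennreal (index_prod (- {i}) (\<lambda>j. 1 - s * block_prob \<mu> c (path_loss lamc \<alpha> (norm (X j \<omega> - X i \<omega>))))) \<partial>lborel) \<partial>M) =
      (\<integral>\<^sup>+s. indicator {0..1} s * (\<integral>\<^sup>+\<omega>. indicator B (X i \<omega>) * ?p s i \<omega> \<partial>M) \<partial>lborel)" for i
  proof -
    \<comment> \<open>The exceptional null set is the failure of injectivity. It is the same for all
      \<open>s\<close>, so the kernels may be exchanged inside the inner integral.\<close>
    have "AE \<omega> in M. \<forall>s. index_prod (- {i}) (\<lambda>j. 1 - s * block_prob \<mu> c (path_loss lamc \<alpha> (norm (X j \<omega> - X i \<omega>)))) =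
        index_prod (- {i}) (\<lambda>j. 1 - s * signal_decay \<kappa> \<alpha> (X j \<omega> - X i \<omega>))"
      using AE_inj
    proof eventually_elim
      case (elim \<omega>)
      then have "X j \<omega> \<noteq> X i \<omega>" if "j \<noteq> i" for j using that by (auto dest: injD)
      then have "block_prob \<mu> c (path_loss lamc \<alpha> (norm (X j \<omega> - X i \<omega>))) = signal_decay \<kappa> \<alpha> (X j \<omega> - X i \<omega>)"
        if "j \<noteq> i" for j
        unfolding \<kappa> using that by (intro block_prob_path_loss pos(1-3)) auto
      then show ?case by (intro allI index_prod_cong) simp
    qed
    then have "(\<integral>\<^sup>+\<omega>. indicator B (X i \<omega>) * (\<integral>\<^sup>+s. indicator {0..1} s *
        ennreal (index_prod (- {i}) (\<lambda>j. 1 - s * block_prob \<mu> c (path_loss lamc \<alpha> (norm (X j \<omega> - X i \<omega>))))) \<partial>lborel) \<partial>M) =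
        (\<integral>\<^sup>+\<omega>. indicator B (X i \<omega>) * (\<integral>\<^sup>+s. indicator {0..1} s * ?p s i \<omega> \<partial>lborel) \<partial>M)"
      by (intro nn_integral_cong_AE) auto
    also have "\<dots> = (\<integral>\<^sup>+\<omega>. (\<integral>\<^sup>+s. indicator B (X i \<omega>) * (indicator {0..1} s * ?p s i \<omega>) \<partial>lborel) \<partial>M)"
      by (intro nn_integral_cong nn_integral_cmult[symmetric]) measurable
    also have "\<dots> = (\<integral>\<^sup>+s. (\<integral>\<^sup>+\<omega>. indicator B (X i \<omega>) * (indicator {0..1} s * ?p s i \<omega>) \<partial>M) \<partial>lborel)"
      by (rule L.Fubini') measurable
    also have "\<dots> = (\<integral>\<^sup>+s. (\<integral>\<^sup>+\<omega>. indicator {0..1} s * (indicator B (X i \<omega>) * ?p s i \<omega>) \<partial>M) \<partial>lborel)"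
      by (simp add: ac_simps)
    also have "\<dots> = (\<integral>\<^sup>+s. indicator {0..1} s * (\<integral>\<^sup>+\<omega>. indicator B (X i \<omega>) * ?p s i \<omega> \<partial>M) \<partial>lborel)"
      by (intro nn_integral_cong nn_integral_cmult) measurable
    finally show ?thesis .
  qed
  then have "(\<Sum>i. \<integral>\<^sup>+\<omega>. indicator B (X i \<omega>) * (\<integral>\<^sup>+s. indicator {0..1} s *
        ennreal (index_prod (- {i}) (\<lambda>j. 1 - s * block_prob \<mu> c (path_loss lamc \<alpha> (norm (X j \<omega> - X i \<omega>))))) \<partial>lborel) \<partial>M) =
      (\<Sum>i. \<integral>\<^sup>+s. indicator {0..1} s * (\<integral>\<^sup>+\<omega>. indicator B (X i \<omega>) * ?p s i \<omega> \<partial>M) \<partial>lborel)"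
    by simp
  also have "\<dots> = (\<integral>\<^sup>+s. (\<Sum>i. indicator {0..1} s * (\<integral>\<^sup>+\<omega>. indicator B (X i \<omega>) * ?p s i \<omega> \<partial>M)) \<partial>lborel)"
    by (rule nn_integral_suminf[symmetric]) measurable
  also have "\<dots> = (\<integral>\<^sup>+s. indicator {0..1} s * (\<integral>\<^sup>+\<omega>. (\<Sum>i. indicator B (X i \<omega>) * ?p s i \<omega>) \<partial>M) \<partial>lborel)"
    by (intro nn_integral_cong) (subst nn_integral_suminf; measurable; simp)
  also have "\<dots> = (\<integral>\<^sup>+s. (ennreal lam * emeasure lborel B) * (indicator {0..1} s * ennreal (exp (- (s * N)))) \<partial>lborel)"
  proof (rule nn_integral_cong)
    fix s :: real
    show "indicator {0..1} s * (\<integral>\<^sup>+\<omega>. (\<Sum>i. indicator B (X i \<omega>) * ?p s i \<omega>) \<partial>M) =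
        (ennreal lam * emeasure lborel B) * (indicator {0..1} s * ennreal (exp (- (s * N))))"
      by (cases "s \<in> {0..1}") (simp_all add: mecke_s)
  qed
  also have "\<dots> = (ennreal lam * emeasure lborel B) * (\<integral>\<^sup>+s. indicator {0..1} s * ennreal (exp (- (s * N))) \<partial>lborel)"
    by (rule nn_integral_cmult) measurable
  finally show ?thesis by (simp add: nn_integral_exp_unit_interval[OF N0])
qed

text \<open>A variable with values 0 and 1 is the indicator of the event that it equals 1, and
  nonnegativity lets the sum leave the integral.\<close>

lemma palm_prob_zero_one:
  assumes A: "\<And>i. A i \<in> borel_measurable M" "\<And>i \<omega>. A i \<omega> \<in> {0, 1 :: real}" and B: "B \<in> sets borel"
  shows "palm_prob M lam X B (\<lambda>i \<omega>. A i \<omega> = 1) =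
    (\<Sum>i. \<integral>\<^sup>+\<omega>. indicator B (X i \<omega>) * ennreal (A i \<omega>) \<partial>M) / (ennreal lam * emeasure lborel B)"
proof -
  note [measurable] = A(1) B
  have "indicator {i. X i \<omega> \<in> B \<and> A i \<omega> = 1} i = indicator B (X i \<omega>) * ennreal (A i \<omega>)" for i \<omega>
    using A(2)[of i \<omega>] by (auto simp: indicator_def)
  then show ?thesis
    unfolding palm_prob_def by (simp add: nn_integral_suminf)
qed

lemma window_scale_cancel:
  assumes "0 < emeasure lborel B" "emeasure lborel B < \<infinity>"
  shows "(ennreal lam * emeasure lborel (B :: (real^2) set) * x) / (ennreal lam * emeasure lborel B) = x"
proof -
  have "ennreal lam * emeasure lborel B \<noteq> 0" "ennreal lam * emeasure lborel B \<noteq> top"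
    using assms intensity_pos by (auto simp: ennreal_mult_eq_top_iff)
  then show ?thesis
    by (metis ennreal_mult_divide_eq mult.commute)
qed

end

lemma (in independent_sources) measurable_Sig_vimage:
  assumes "E s = sets (vimage_algebra (space M) f N)" "f \<in> space M \<rightarrow> space N"
  shows "f \<in> measurable (Sig {s}) N"
proof -
  have "sets (vimage_algebra (space M) f N) \<subseteq> sets (Sig {s})"
    unfolding sets_Sig using assms(1) by auto
  with measurable_vimage_algebra1[OF assms(2)] show ?thesis
    by (auto simp: measurable_def)
qed

theorem lemma9:
  fixes M :: "'a measure"
    and X Y :: "nat \<Rightarrow> 'a \<Rightarrow> real^2"
    and tW tL :: "nat \<Rightarrow> 'a \<Rightarrow> real"
    and GW GWL GL :: "nat \<Rightarrow> nat \<Rightarrow> 'a \<Rightarrow> real"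
    and lamW lamL PW PL lamc \<alpha> \<mu> \<Gamma>cs \<Gamma>L NW :: real
    and B :: "(real^2) set"
  assumes "prob_space M"
    and "lamW > 0" and "lamL > 0" and "PW > 0" and "PL > 0" and "lamc > 0"
    and "\<alpha> > 0" and "\<mu> > 0" and "\<Gamma>cs > 0" and "\<Gamma>L > 0"
    and "homogeneous_poisson_process M lamW X"
    and "homogeneous_poisson_process M lamL Y"
    and "\<And>i. distributed M lborel (tW i) (\<lambda>x. indicator {0..1::real} x / measure lborel {0..1::real})"
    and "\<And>k. distributed M lborel (tL k) (\<lambda>x. indicator {1..2::real} x / measure lborel {1..2::real})"
    and "\<And>j i. distributed M lborel (GW j i) (exponential_density \<mu>)"
    and "\<And>j k. distributed M lborel (GWL j k) (exponential_density \<mu>)"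
    and "\<And>m k. distributed M lborel (GL m k) (exponential_density \<mu>)"
    and "sources_independent M X Y tW tL GW GWL GL"
    and "NW = N3 lamc \<alpha> \<mu> lamW PW \<Gamma>cs"
    and "B \<in> sets borel" and "0 < emeasure lborel B" and "emeasure lborel B < \<infinity>"
  shows "palm_prob M lamW X B (\<lambda>i \<omega>. wifi_access lamc \<alpha> PW \<Gamma>cs X tW GW i \<omega> = 1) =
           ennreal ((1 - exp (- NW)) / NW) \<and>
         palm_prob M lamL Y B (\<lambda>k \<omega>. lte_access lamc \<alpha> PW PL \<Gamma>L X Y tL GWL GL k \<omega> = 1) =
           ennreal (exp (- N3 lamc \<alpha> \<mu> lamW PW \<Gamma>L) *
             ((1 - exp (- N3 lamc \<alpha> \<mu> lamL PL \<Gamma>L)) / N3 lamc \<alpha> \<mu> lamL PL \<Gamma>L))"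
proof -
  interpret P: prob_space M by fact
  interpret APs: planar_poisson M lamW X by unfold_locales fact+
  interpret ENBs: planar_poisson M lamL Y by unfold_locales fact+
  define E where "E = source_events M X Y tW tL GW GWL GL"
  interpret S: independent_sources M E
  proof
    show "P.indep_sets E UNIV"
      using assms(18) by (simp add: sources_independent_def E_def)
    show "Int_stable (E s)" for s
      unfolding E_def source_events_def by (rule sets.Int_stable)
  qed

  \<comment> \<open>The points of one process depend on each other, so the whole enumeration is a
    single random element of sequence space, belonging to a single source.\<close>
  have XS: "(\<lambda>\<omega> i. X i \<omega>) \<in> measurable (S.Sig {APs}) (\<Pi>\<^sub>M i\<in>UNIV. borel)"
    and YS: "(\<lambda>\<omega> i. Y i \<omega>) \<in> measurable (S.Sig {ENBs}) (\<Pi>\<^sub>M i\<in>UNIV. borel)"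
    by (rule S.measurable_Sig_vimage; simp add: E_def source_events_def space_PiM)+
  have X: "X i \<in> borel_measurable (S.Sig K)" if "APs \<in> K" for i K
    by (rule S.measurable_Sig_mono[OF measurable_compose[OF XS measurable_component_singleton[of i]]])
      (use that in auto)
  have Y: "Y i \<in> borel_measurable (S.Sig K)" if "ENBs \<in> K" for i K
    by (rule S.measurable_Sig_mono[OF measurable_compose[OF YS measurable_component_singleton[of i]]])
      (use that in auto)
  have tW: "tW j \<in> borel_measurable (S.Sig {Timer_W j})"
    and tL: "tL j \<in> borel_measurable (S.Sig {Timer_L j})" for j
    by (rule S.measurable_Sig_vimage; simp add: E_def source_events_def)+
  have GW: "GW j i \<in> borel_measurable (S.Sig {Fading_W j i})"
    and GWL: "GWL j i \<in> borel_measurable (S.Sig {Fading_WL j i})"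
    and GL: "GL j i \<in> borel_measurable (S.Sig {Fading_L j i})" for j i
    by (rule S.measurable_Sig_vimage; simp add: E_def source_events_def)+
  note [measurable] = S.measurable_Sig[OF tW] S.measurable_Sig[OF tL]
    S.measurable_Sig[OF GW] S.measurable_Sig[OF GWL] S.measurable_Sig[OF GL] assms(20)
  \<comment> \<open>The interval is written with \<open>0 + 1\<close> to match
    \<open>{a..a + 1}\<close>; its length 1 turns the density into the plain indicator.\<close>
  have tW_law: "distributed M lborel (tW j) (indicator {0..0 + 1 :: real})" for j
    using assms(13)[of j] by (simp add: ennreal_indicator)
  have tL_law: "distributed M lborel (tL j) (indicator {1..1 + 1 :: real})" for j
    using assms(14)[of j] by (simp add: ennreal_indicator)
  have c_pos: "0 < \<Gamma>cs / PW" "0 < \<Gamma>L / PW" "0 < \<Gamma>L / PL"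
    using assms by auto
  define \<kappa> where "\<kappa> c = \<mu> * c * (4 * pi / lamc)\<^sup>2" for c
  have N3: "N3 lamc \<alpha> \<mu> lam P \<Gamma> = lam * (LINT x|lborel. signal_decay (\<kappa> (\<Gamma> / P)) \<alpha> x)" for lam P \<Gamma>
    by (simp add: N3_def signal_decay_def path_loss_def \<kappa>_def ac_simps)
  define WL where "WL i \<omega> = index_prod UNIV (\<lambda>j.
       of_bool (GWL j i \<omega> / path_loss lamc \<alpha> (norm (X j \<omega> - Y i \<omega>)) \<le> \<Gamma>L / PW))" for i \<omega>
  define LL where "LL i \<omega> = index_prod (- {i}) (\<lambda>m. backoff_factor (\<Gamma>L / PL) (tL m \<omega>) (tL i \<omega>)
      (GL m i \<omega>) (path_loss lamc \<alpha> (norm (Y m \<omega> - Y i \<omega>))))" for i \<omega>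
  have lte: "lte_access lamc \<alpha> PW PL \<Gamma>L X Y tL GWL GL i \<omega> = WL i \<omega> * LL i \<omega>" for i \<omega>
    by (simp add: lte_access_def WL_def LL_def backoff_factor_def)
  have wifi: "wifi_access lamc \<alpha> PW \<Gamma>cs X tW GW i \<omega> = index_prod (- {i}) (\<lambda>j. backoff_factor (\<Gamma>cs / PW)
      (tW j \<omega>) (tW i \<omega>) (GW j i \<omega>) (path_loss lamc \<alpha> (norm (X j \<omega> - X i \<omega>))))" for i \<omega>
    by (simp add: wifi_access_def backoff_factor_def)
  have WL01: "WL i \<omega> \<in> {0, 1}" for i \<omega>
    unfolding WL_def by (rule index_prod_zero_one) auto
  have LL01: "LL i \<omega> \<in> {0, 1}" for i \<omega>
    unfolding LL_def by (rule index_prod_zero_one) (rule backoff_factor_zero_one)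
  have wifi01: "wifi_access lamc \<alpha> PW \<Gamma>cs X tW GW i \<omega> \<in> {0, 1}" for i \<omega>
    unfolding wifi by (rule index_prod_zero_one) (rule backoff_factor_zero_one)
  have lte01: "lte_access lamc \<alpha> PW PL \<Gamma>L X Y tL GWL GL i \<omega> \<in> {0, 1}" for i \<omega>
    using WL01[of i \<omega>] LL01[of i \<omega>] by (auto simp: lte)

  have wifi_term: "(\<integral>\<^sup>+\<omega>. indicator B (X i \<omega>) * ennreal (wifi_access lamc \<alpha> PW \<Gamma>cs X tW GW i \<omega>) \<partial>M) =
      (\<integral>\<^sup>+\<omega>. indicator B (X i \<omega>) * (\<integral>\<^sup>+s. indicator {0..1} s * ennreal (index_prod (- {i})
        (\<lambda>j. 1 - s * block_prob \<mu> (\<Gamma>cs / PW) (path_loss lamc \<alpha> (norm (X j \<omega> - X i \<omega>))))) \<partial>lborel) \<partial>M)" for i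
    unfolding wifi
  \<comment> \<open>The receiver \<open>i\<close> is fixed, so the fadings towards it are indexed
    injectively by their transmitter. The only retained information is the AP enumeration.\<close>
  proof (rule S.nn_integral_backoff_limit[where tau = Timer_W and gam = "\<lambda>j. Fading_W j i" and K = "{APs}" and a = 0])
    note [measurable] = X[of "{APs}"]
    show "(\<lambda>\<omega>. path_loss lamc \<alpha> (norm (X j \<omega> - X i \<omega>))) \<in> borel_measurable (S.Sig {APs})" for j
      by measurable
    show "(\<lambda>\<omega>. indicator B (X i \<omega>)) \<in> borel_measurable (S.Sig {APs})"
      by measurable
  qed (use tW tW_law GW assms(8,15) c_pos path_loss_nonneg in \<open>auto simp: inj_def indicator_def\<close>)
  have "palm_prob M lamW X B (\<lambda>i \<omega>. wifi_access lamc \<alpha> PW \<Gamma>cs X tW GW i \<omega> = 1) =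
      (\<Sum>i. \<integral>\<^sup>+\<omega>. indicator B (X i \<omega>) * ennreal (wifi_access lamc \<alpha> PW \<Gamma>cs X tW GW i \<omega>) \<partial>M) /
      (ennreal lamW * emeasure lborel B)"
  proof (rule APs.palm_prob_zero_one[OF _ wifi01 assms(20)])
    show "wifi_access lamc \<alpha> PW \<Gamma>cs X tW GW i \<in> borel_measurable M" for i
      unfolding wifi_access_def[abs_def] by measurable
  qed
  also have "\<dots> = (\<Sum>i. \<integral>\<^sup>+\<omega>. indicator B (X i \<omega>) * (\<integral>\<^sup>+s. indicator {0..1} s * ennreal (index_prod (- {i})
        (\<lambda>j. 1 - s * block_prob \<mu> (\<Gamma>cs / PW) (path_loss lamc \<alpha> (norm (X j \<omega> - X i \<omega>))))) \<partial>lborel) \<partial>M) /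
      (ennreal lamW * emeasure lborel B)"
    by (simp add: wifi_term)
  also have "(\<Sum>i. \<integral>\<^sup>+\<omega>. indicator B (X i \<omega>) * (\<integral>\<^sup>+s. indicator {0..1} s * ennreal (index_prod (- {i})
        (\<lambda>j. 1 - s * block_prob \<mu> (\<Gamma>cs / PW) (path_loss lamc \<alpha> (norm (X j \<omega> - X i \<omega>))))) \<partial>lborel) \<partial>M) =
      ennreal lamW * emeasure lborel B * ennreal ((1 - exp (- NW)) / NW)"
    by (rule APs.mecke_backoff[where \<kappa> = "\<kappa> (\<Gamma>cs / PW)"]) (use assms c_pos in \<open>auto simp: \<kappa>_def N3\<close>)
  also have "\<dots> / (ennreal lamW * emeasure lborel B) = ennreal ((1 - exp (- NW)) / NW)"
    by (rule APs.window_scale_cancel[OF assms(21,22)])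
  finally have wifi_palm: "palm_prob M lamW X B (\<lambda>i \<omega>. wifi_access lamc \<alpha> PW \<Gamma>cs X tW GW i \<omega> = 1) =
      ennreal ((1 - exp (- NW)) / NW)" .

  let ?NW = "N3 lamc \<alpha> \<mu> lamW PW \<Gamma>L" and ?NL = "N3 lamc \<alpha> \<mu> lamL PL \<Gamma>L"
  \<comment> \<open>The conditional probability that LTE back-off lets eNB \<open>i\<close>
    transmit, given the eNB positions. It is a function of these positions alone.\<close>
  define R where "R i \<omega> = (\<integral>\<^sup>+s. indicator {0..1} s * ennreal (index_prod (- {i})
        (\<lambda>j. 1 - s * block_prob \<mu> (\<Gamma>L / PL) (path_loss lamc \<alpha> (norm (Y j \<omega> - Y i \<omega>))))) \<partial>lborel)" for i \<omega>
  have R1: "R i \<omega> \<le> 1" for i \<omega>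
  proof -
    have "R i \<omega> \<le> (\<integral>\<^sup>+s. indicator {0..1 :: real} s \<partial>lborel)"
      unfolding R_def
    proof (rule nn_integral_mono)
      fix s :: real
      have "index_prod (- {i}) (\<lambda>j. 1 - s * block_prob \<mu> (\<Gamma>L / PL) (path_loss lamc \<alpha> (norm (Y j \<omega> - Y i \<omega>)))) \<le> 1"
        if "0 \<le> s" "s \<le> 1"
      proof (rule index_prod_le_1)
        fix j
        have "0 \<le> block_prob \<mu> (\<Gamma>L / PL) (path_loss lamc \<alpha> (norm (Y j \<omega> - Y i \<omega>)))"
          "block_prob \<mu> (\<Gamma>L / PL) (path_loss lamc \<alpha> (norm (Y j \<omega> - Y i \<omega>))) \<le> 1"
          by (rule block_prob_bounds[OF assms(8) c_pos(3) path_loss_nonneg])+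
        then show "0 \<le> 1 - s * block_prob \<mu> (\<Gamma>L / PL) (path_loss lamc \<alpha> (norm (Y j \<omega> - Y i \<omega>)))"
          "1 - s * block_prob \<mu> (\<Gamma>L / PL) (path_loss lamc \<alpha> (norm (Y j \<omega> - Y i \<omega>))) \<le> 1"
          using that by (auto simp: mult_le_one)
      qed
      then show "indicator {0..1} s * ennreal (index_prod (- {i})
          (\<lambda>j. 1 - s * block_prob \<mu> (\<Gamma>L / PL) (path_loss lamc \<alpha> (norm (Y j \<omega> - Y i \<omega>))))) \<le> indicator {0..1} s"
        by (auto simp: indicator_def)
    qed
    then show ?thesis by simp
  qed
  have R_meas: "R i \<in> borel_measurable (S.Sig K)" if K: "ENBs \<in> K" for i K
  proof -
    note [measurable] = Y[OF K]
    show ?thesis unfolding R_def[abs_def] by measurable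
  qed

  have lte_term: "(\<integral>\<^sup>+\<omega>. indicator B (Y i \<omega>) * ennreal (lte_access lamc \<alpha> PW PL \<Gamma>L X Y tL GWL GL i \<omega>) \<partial>M) =
      ennreal (exp (- ?NW)) * (\<integral>\<^sup>+\<omega>. indicator B (Y i \<omega>) * R i \<omega> \<partial>M)" for i
  proof -
    \<comment> \<open>The sensing factor \<open>WL i\<close> is carried along in \<open>H\<close>
      while the LTE back-off is averaged, so the fadings from the APs to eNB \<open>i\<close> belong
      to the retained information.\<close>
    let ?K = "{APs, ENBs} \<union> range (\<lambda>j. Fading_WL j i)"
    have "(\<integral>\<^sup>+\<omega>. indicator B (Y i \<omega>) * ennreal (lte_access lamc \<alpha> PW PL \<Gamma>L X Y tL GWL GL i \<omega>) \<partial>M) =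
        (\<integral>\<^sup>+\<omega>. (indicator B (Y i \<omega>) * ennreal (WL i \<omega>)) * ennreal (LL i \<omega>) \<partial>M)"
    proof (rule nn_integral_cong)
      fix \<omega>
      show "indicator B (Y i \<omega>) * ennreal (lte_access lamc \<alpha> PW PL \<Gamma>L X Y tL GWL GL i \<omega>) =
          indicator B (Y i \<omega>) * ennreal (WL i \<omega>) * ennreal (LL i \<omega>)"
        using WL01[of i \<omega>] LL01[of i \<omega>] by (auto simp: lte)
    qed
    also have "\<dots> = (\<integral>\<^sup>+\<omega>. (indicator B (Y i \<omega>) * ennreal (WL i \<omega>)) * R i \<omega> \<partial>M)"
      unfolding LL_def R_def
    proof (rule S.nn_integral_backoff_limit[where tau = Timer_L and gam = "\<lambda>m. Fading_L m i" and K = ?K and a = 1])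
      have GWLK: "GWL j i \<in> borel_measurable (S.Sig ?K)" for j
        by (rule S.measurable_Sig_mono[OF GWL]) auto
      have XK: "X j \<in> borel_measurable (S.Sig ?K)" and YK: "Y j \<in> borel_measurable (S.Sig ?K)" for j
        by (auto intro: X Y)
      note [measurable] = XK YK GWLK
      show "(\<lambda>\<omega>. path_loss lamc \<alpha> (norm (Y j \<omega> - Y i \<omega>))) \<in> borel_measurable (S.Sig ?K)" for j
        by measurable
      show "(\<lambda>\<omega>. indicator B (Y i \<omega>) * ennreal (WL i \<omega>)) \<in> borel_measurable (S.Sig ?K)"
        unfolding WL_def by measurable
      show "indicator B (Y i \<omega>) * ennreal (WL i \<omega>) \<le> 1" for \<omega>
        using WL01[of i \<omega>] by (auto simp: indicator_def)
    qed (use tL tL_law GL assms(8,17) c_pos path_loss_nonneg in \<open>auto simp: inj_def\<close>)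
    also have "\<dots> = (\<integral>\<^sup>+\<omega>. (indicator B (Y i \<omega>) * R i \<omega>) * ennreal (WL i \<omega>) \<partial>M)"
      by (simp add: ac_simps)
    \<comment> \<open>The roles are exchanged: \<open>R i\<close> is retained, and the fadings from
      the APs are averaged given both point processes.\<close>
    also have "\<dots> = (\<integral>\<^sup>+\<omega>. (indicator B (Y i \<omega>) * R i \<omega>) * ennreal (index_prod UNIV (\<lambda>j.
        1 - block_prob \<mu> (\<Gamma>L / PW) (path_loss lamc \<alpha> (norm (X j \<omega> - Y i \<omega>))))) \<partial>M)"
      unfolding WL_def
    proof (rule S.nn_integral_sensing_limit[where gam = "\<lambda>j. Fading_WL j i" and K = "{APs, ENBs}"])
      have XK: "X j \<in> borel_measurable (S.Sig {APs, ENBs})" and YK: "Y j \<in> borel_measurable (S.Sig {APs, ENBs})" for j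
        by (auto intro: X Y)
      note [measurable] = XK YK R_meas[of "{APs, ENBs}", simplified]
      show "(\<lambda>\<omega>. path_loss lamc \<alpha> (norm (X j \<omega> - Y i \<omega>))) \<in> borel_measurable (S.Sig {APs, ENBs})" for j
        by measurable
      show "(\<lambda>\<omega>. indicator B (Y i \<omega>) * R i \<omega>) \<in> borel_measurable (S.Sig {APs, ENBs})"
        by measurable
      show "indicator B (Y i \<omega>) * R i \<omega> \<le> 1" for \<omega>
        using R1[of i \<omega>] by (auto simp: indicator_def)
    qed (use GWL assms(8,16) c_pos path_loss_nonneg in \<open>auto simp: inj_def\<close>)
    also have "\<dots> = (\<integral>\<^sup>+\<omega>. (\<integral>\<^sup>+x. (indicator B (Y i \<omega>) * R i \<omega>) * ennreal (index_prod UNIV (\<lambda>j.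
        1 - block_prob \<mu> (\<Gamma>L / PW) (path_loss lamc \<alpha> (norm (x j - Y i \<omega>)))))
        \<partial>distr M (\<Pi>\<^sub>M i\<in>UNIV. borel) (\<lambda>\<omega> i. X i \<omega>)) \<partial>M)"
    proof (rule S.nn_integral_freeze_source[OF XS, where F = "\<lambda>\<omega> x. (indicator B (Y i \<omega>) * R i \<omega>) * ennreal (index_prod UNIV (\<lambda>j.
        1 - block_prob \<mu> (\<Gamma>L / PW) (path_loss lamc \<alpha> (norm (x j - Y i \<omega>)))))"])
      note [measurable] = Y[of "- {APs}", simplified] R_meas[of "- {APs}", simplified]
      show "(\<lambda>(\<omega>, x). (indicator B (Y i \<omega>) * R i \<omega>) * ennreal (index_prod UNIV (\<lambda>j.
          1 - block_prob \<mu> (\<Gamma>L / PW) (path_loss lamc \<alpha> (norm (x j - Y i \<omega>))))))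
        \<in> borel_measurable (S.Sig (- {APs}) \<Otimes>\<^sub>M (\<Pi>\<^sub>M i\<in>UNIV. borel))"
        by measurable
    qed
    also have "\<dots> = (\<integral>\<^sup>+\<omega>. (indicator B (Y i \<omega>) * R i \<omega>) * ennreal (exp (- ?NW)) \<partial>M)"
    proof (rule nn_integral_cong)
      fix \<omega>
      let ?f = "\<lambda>x. ennreal (index_prod UNIV (\<lambda>j. 1 - block_prob \<mu> (\<Gamma>L / PW) (path_loss lamc \<alpha> (norm (x j - Y i \<omega>)))))"
      have f: "?f \<in> borel_measurable (\<Pi>\<^sub>M i\<in>UNIV. borel)" by measurable
      have "(\<integral>\<^sup>+x. (indicator B (Y i \<omega>) * R i \<omega>) * ?f x \<partial>distr M (\<Pi>\<^sub>M i\<in>UNIV. borel) (\<lambda>\<omega> i. X i \<omega>)) =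
          (indicator B (Y i \<omega>) * R i \<omega>) * (\<integral>\<^sup>+\<omega>'. ?f (\<lambda>i. X i \<omega>') \<partial>M)"
        using f S.measurable_Sig[OF XS] by (subst nn_integral_cmult) (auto simp: nn_integral_distr)
      also have "(\<integral>\<^sup>+\<omega>'. ?f (\<lambda>i. X i \<omega>') \<partial>M) = ennreal (exp (- ?NW))"
        unfolding N3 by (rule APs.laplace_sensing) (use assms c_pos in \<open>auto simp: \<kappa>_def\<close>)
      finally show "(\<integral>\<^sup>+x. (indicator B (Y i \<omega>) * R i \<omega>) * ?f x \<partial>distr M (\<Pi>\<^sub>M i\<in>UNIV. borel) (\<lambda>\<omega> i. X i \<omega>)) =
          (indicator B (Y i \<omega>) * R i \<omega>) * ennreal (exp (- ?NW))" .
    qed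
    also have "\<dots> = ennreal (exp (- ?NW)) * (\<integral>\<^sup>+\<omega>. indicator B (Y i \<omega>) * R i \<omega> \<partial>M)"
    proof -
      have [measurable]: "R i \<in> borel_measurable M"
        using S.measurable_Sig[OF R_meas[of UNIV]] by simp
      show ?thesis by (subst nn_integral_multc) (auto simp: mult.commute)
    qed
    finally show ?thesis .
  qed
  have "palm_prob M lamL Y B (\<lambda>i \<omega>. lte_access lamc \<alpha> PW PL \<Gamma>L X Y tL GWL GL i \<omega> = 1) =
      (\<Sum>i. \<integral>\<^sup>+\<omega>. indicator B (Y i \<omega>) * ennreal (lte_access lamc \<alpha> PW PL \<Gamma>L X Y tL GWL GL i \<omega>) \<partial>M) /
      (ennreal lamL * emeasure lborel B)"
  proof (rule ENBs.palm_prob_zero_one[OF _ lte01 assms(20)])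
    show "lte_access lamc \<alpha> PW PL \<Gamma>L X Y tL GWL GL i \<in> borel_measurable M" for i
      unfolding lte_access_def[abs_def] by measurable
  qed
  also have "\<dots> = (ennreal (exp (- ?NW)) * (\<Sum>i. \<integral>\<^sup>+\<omega>. indicator B (Y i \<omega>) * R i \<omega> \<partial>M)) /
      (ennreal lamL * emeasure lborel B)"
    by (simp add: lte_term)
  also have "(\<Sum>i. \<integral>\<^sup>+\<omega>. indicator B (Y i \<omega>) * R i \<omega> \<partial>M) =
      ennreal lamL * emeasure lborel B * ennreal ((1 - exp (- ?NL)) / ?NL)"
    unfolding R_def
    by (rule ENBs.mecke_backoff[where \<kappa> = "\<kappa> (\<Gamma>L / PL)"]) (use assms c_pos in \<open>auto simp: \<kappa>_def N3\<close>)
  also have "ennreal (exp (- ?NW)) * (ennreal lamL * emeasure lborel B * ennreal ((1 - exp (- ?NL)) / ?NL)) =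
      ennreal lamL * emeasure lborel B * (ennreal (exp (- ?NW)) * ennreal ((1 - exp (- ?NL)) / ?NL))"
    by (simp add: ac_simps)
  also have "\<dots> / (ennreal lamL * emeasure lborel B) = ennreal (exp (- ?NW)) * ennreal ((1 - exp (- ?NL)) / ?NL)"
    by (rule ENBs.window_scale_cancel[OF assms(21,22)])
  also have "\<dots> = ennreal (exp (- ?NW) * ((1 - exp (- ?NL)) / ?NL))"
    by (rule ennreal_mult'[symmetric]) simp
  finally show ?thesis using wifi_palm by blast
qed

end
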